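(* Let $\Lambda\subset\mathbb{R}^n$ be a lattice such that $\mathbb{Z}^n\subset\Lambda$, and let $v\in\mathbb{R}^n$. Then for $0<\tau\le1$ we have $$41\,e^{-\pi^2/\tau}\operatorname{dist}^2(v,\Lambda)\ \ge\ \ln\frac{\Theta(\tau I)}{\Theta_\Lambda(\tau,v)}\ \ge\ 13\,e^{-\pi^2/\tau}\operatorname{dist}^2(v,\Lambda)+\ln\det\Lambda .$$
   Context: A lattice $\Lambda\subset\mathbb{R}^n$ is a discrete additive subgroup spanning $\mathbb{R}^n$; $\det\Lambda=\sqrt{\det B}$, where $B$ is the Gram matrix of any basis of $\Lambda$. $\operatorname{dist}(v,\Lambda)=\min_{u\in\Lambda}\|u-v\|$ with $\|\cdot\|$ the Euclidean norm. $\Theta_\Lambda(\tau,v)=\sum_{u\in\Lambda}e^{-\tau\|u-v\|^2}$ and $\Theta(\tau I)=\sum_{x\in\mathbb{Z}^n}e^{-\tau\|x\|^2}$. *)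

theory Defs
  imports "HOL-Analysis.Analysis"
begin

definition euclidean_lattice :: "(real ^ 'n) set \<Rightarrow> bool" where
  "euclidean_lattice \<Lambda> \<longleftrightarrow>
     0 \<in> \<Lambda> \<and> (\<forall>x\<in>\<Lambda>. \<forall>y\<in>\<Lambda>. x - y \<in> \<Lambda>) \<and> discrete \<Lambda> \<and> span \<Lambda> = UNIV"

definition integer_lattice :: "(real ^ 'n) set" where
  "integer_lattice = {x. \<forall>i. x $ i \<in> \<int>}"

definition lattice_basis :: "('n \<Rightarrow> real ^ 'n) \<Rightarrow> (real ^ 'n) set \<Rightarrow> bool" where
  "lattice_basis b \<Lambda> \<longleftrightarrow>
     inj b \<and> independent (range b) \<and>
     \<Lambda> = {\<Sum>i\<in>UNIV. of_int (c i) *\<^sub>R b i | c :: 'n \<Rightarrow> int. True}"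

definition gram_matrix :: "('n \<Rightarrow> real ^ 'n) \<Rightarrow> real ^ 'n ^ 'n" where
  "gram_matrix b = (\<chi> i j. b i \<bullet> b j)"

text \<open>The value does not depend on the chosen basis, see \<open>lattice_det_eq\<close> below.\<close>
definition lattice_det :: "(real ^ 'n) set \<Rightarrow> real" where
  "lattice_det \<Lambda> = sqrt (det (gram_matrix (SOME b. lattice_basis b \<Lambda>)))"

definition lattice_theta :: "(real ^ 'n) set \<Rightarrow> real \<Rightarrow> real ^ 'n \<Rightarrow> real" where
  "lattice_theta \<Lambda> \<tau> v = (\<Sum>\<^sub>\<infinity>u\<in>\<Lambda>. exp (- \<tau> * (norm (u - v))\<^sup>2))"

text \<open>This is \<open>\<Theta>(\<tau>I)\<close>; the dimension is passed as a type.\<close>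
definition integer_theta :: "'n::finite itself \<Rightarrow> real \<Rightarrow> real" where
  "integer_theta _ \<tau> =
     (\<Sum>\<^sub>\<infinity>x\<in>(integer_lattice :: (real ^ 'n) set). exp (- \<tau> * (norm x)\<^sup>2))"

lemma gram_matrix_change:
  fixes b b' :: "'n::finite \<Rightarrow> real ^ 'n"
  assumes "\<And>i. b' i = (\<Sum>j\<in>UNIV. of_int (c i j) *\<^sub>R b j)"
  defines "U \<equiv> \<chi> i j. of_int (c i j)"
  shows "gram_matrix b' = U ** gram_matrix b ** transpose U"
proof -
  have "b' i \<bullet> b' k = (\<Sum>l\<in>UNIV. (\<Sum>j\<in>UNIV. of_int (c i j) * (b j \<bullet> b l)) * of_int (c k l))"
    for i k
    unfolding assms(1) inner_sum_right
    by (intro sum.cong refl) (simp add: inner_sum_left mult.commute)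
  thus ?thesis
    by (simp add: gram_matrix_def U_def matrix_matrix_mult_def transpose_def vec_eq_iff)
qed

lemma lattice_basis_transition:
  fixes b b' :: "'n::finite \<Rightarrow> real ^ 'n"
  assumes b: "lattice_basis b \<Lambda>" and b': "lattice_basis b' \<Lambda>"
  obtains c where "\<And>i. b' i = (\<Sum>j\<in>UNIV. of_int (c i j) *\<^sub>R b j)"
proof -
  have "b' i \<in> \<Lambda>" for i
  proof -
    have "b' i = (\<Sum>j\<in>UNIV. of_int (if j = i then 1 else 0) *\<^sub>R b' j)"
      by (subst sum.remove[of _ i]) auto
    moreover have "\<Lambda> = {\<Sum>i\<in>UNIV. of_int (c i) *\<^sub>R b' i | c :: 'n \<Rightarrow> int. True}"
      using b' by (simp add: lattice_basis_def)
    ultimately show ?thesis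
      by (intro ssubst[where P = "\<lambda>S. b' i \<in> S", of \<Lambda>] CollectI exI conjI TrueI) auto
  qed
  hence "\<forall>i. \<exists>c. b' i = (\<Sum>j\<in>UNIV. of_int (c j) *\<^sub>R b j)"
    using b unfolding lattice_basis_def by blast
  thus ?thesis using that by metis
qed

lemma det_gram_pos:
  fixes b :: "'n::finite \<Rightarrow> real ^ 'n"
  assumes "lattice_basis b \<Lambda>"
  shows "det (gram_matrix b) > 0"
proof -
  let ?A = "\<chi> i. b i"
  have "gram_matrix b = ?A ** transpose ?A"
    by (simp add: gram_matrix_def matrix_matrix_mult_def transpose_def vec_eq_iff inner_vec_def)
  hence "det (gram_matrix b) = (det ?A)\<^sup>2"
    by (simp add: det_mul power2_eq_square)
  moreover have "det ?A \<noteq> 0"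
  proof
    assume "det ?A = 0"
    hence "\<not> invertible ?A" by (simp add: invertible_det_nz)
    then obtain c i where c: "(\<Sum>i\<in>UNIV. c i *s row i ?A) = 0" "c i \<noteq> 0"
      using matrix_right_invertible_independent_rows[of ?A] invertible_right_inverse by blast
    have r: "row i ?A = b i" for i by (simp add: row_def)
    have inj: "inj b" and ind: "independent (range b)"
      using assms by (auto simp: lattice_basis_def)
    have "(\<Sum>x\<in>range b. c (inv b x) *\<^sub>R x) = 0"
      using c(1) by (simp add: sum.reindex[OF inj] inj r scalar_mult_eq_scaleR)
    hence "c (inv b (b i)) = 0"
      using ind independentD[of "range b" "range b" "\<lambda>x. c (inv b x)" "b i"] by auto
    thus False using c(2) inj by simp
  qed
  ultimately show ?thesis by simp
qed

lemma lattice_det_eq: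
  fixes b :: "'n::finite \<Rightarrow> real ^ 'n"
  assumes b: "lattice_basis b \<Lambda>"
  shows "lattice_det \<Lambda> = sqrt (det (gram_matrix b))"
proof -
  have le: "det (gram_matrix b) \<le> det (gram_matrix b')"
    if b: "lattice_basis b \<Lambda>" and b': "lattice_basis b' \<Lambda>" for b b' :: "'n \<Rightarrow> real ^ 'n"
  proof -
    obtain c where c: "\<And>i. b' i = (\<Sum>j\<in>UNIV. of_int (c i j) *\<^sub>R b j)"
      using lattice_basis_transition[OF b b'] by blast
    define U where "U = (\<chi> i j. real_of_int (c i j))"
    have eq: "det (gram_matrix b') = (det U)\<^sup>2 * det (gram_matrix b)"
      by (simp add: gram_matrix_change[OF c] U_def[symmetric] det_mul power2_eq_square)
    have "det U \<in> \<int>"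
      unfolding det_def U_def by (intro Ints_sum Ints_mult Ints_prod) auto
    moreover have "det U \<noteq> 0" using eq det_gram_pos[OF b'] by auto
    ultimately have "\<bar>det U\<bar> \<ge> 1" by (rule Ints_nonzero_abs_ge1)
    hence "(det U)\<^sup>2 \<ge> 1" by (simp add: abs_le_square_iff[of 1, simplified])
    thus ?thesis using eq det_gram_pos[OF b] by simp
  qed
  have "lattice_basis (SOME b. lattice_basis b \<Lambda>) \<Lambda>"
    using someI[of "\<lambda>b. lattice_basis b \<Lambda>", OF b] .
  thus ?thesis
    unfolding lattice_det_def
    by (intro arg_cong[where f = sqrt] order_antisym le b)
qed

lemma euclidean_lattice_uniform_discrete:
  assumes L: "euclidean_lattice \<Lambda>"
  shows "uniform_discrete \<Lambda>"
proof -
  have "0 isolated_in \<Lambda>"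
    using L by (auto simp: euclidean_lattice_def discrete_def)
  then obtain e where e: "e > 0" "\<And>y. y \<in> \<Lambda> \<Longrightarrow> dist 0 y < e \<Longrightarrow> y = 0"
    by (auto simp: isolated_in_dist_Ex_iff)
  show ?thesis
    unfolding uniform_discrete_def
  proof (intro exI conjI ballI impI)
    fix x y assume "x \<in> \<Lambda>" "y \<in> \<Lambda>" "dist x y < e"
    moreover from this L have "x - y \<in> \<Lambda>" by (auto simp: euclidean_lattice_def)
    ultimately show "x = y" using e(2)[of "x - y"] by (simp add: dist_norm norm_minus_commute)
  qed (rule e(1))
qed

text \<open>Hence \<open>infdist v \<Lambda>\<close> is the minimum of the distances from \<open>v\<close> to lattice points.\<close>
lemma euclidean_lattice_infdist_attained:
  assumes L: "euclidean_lattice \<Lambda>"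
  obtains u where "u \<in> \<Lambda>" "infdist v \<Lambda> = norm (u - v)"
    "\<And>w. w \<in> \<Lambda> \<Longrightarrow> norm (u - v) \<le> norm (w - v)"
proof -
  have "closed \<Lambda>"
    using euclidean_lattice_uniform_discrete[OF L] uniform_discrete_imp_closed by blast
  moreover have "\<Lambda> \<noteq> {}" using L by (auto simp: euclidean_lattice_def)
  ultimately obtain u where "u \<in> \<Lambda>" "infdist v \<Lambda> = dist v u"
    using infdist_attains_inf by blast
  moreover have "norm (w - v) = dist v w" for w
    by (simp add: dist_norm norm_minus_commute)
  ultimately show ?thesis
    using that[of u] infdist_le[of _ \<Lambda> v] by simp
qed

end

theory Submission
  imports Defs "HOL-Probability.Characteristic_Functions"
begin

text \<open>
  Let \<open>q = exp (- (pi\<^sup>2 / \<tau>))\<close>. The theorem reduces to a statement about one real variable: for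
  \<open>\<bar>x\<bar> \<le> 1/2\<close>, the logarithm of the ratio of \<open>\<Sum>k. exp (- \<tau> * k\<^sup>2)\<close> to
  \<open>\<Sum>k. exp (- \<tau> * (k - x)\<^sup>2)\<close>, both over the integers \<open>k\<close>, lies between \<open>13 * q * x\<^sup>2\<close> and
  \<open>41 * q * x\<^sup>2\<close> (lemma \<open>periodic_gaussian_bounds\<close>).

  This follows from Poisson summation (\<open>periodic_gaussian_eq_dual_sum\<close>), which turns the denominator into
  a constant times \<open>1 + 2 * q * cos (2 * pi * x) + 2 * q ^ 4 * cos (4 * pi * x) + \<dots>\<close>. As \<open>q\<close> is tiny
  for \<open>\<tau> \<le> 1\<close>, the ratio exceeds 1 by about \<open>2 * q * (1 - cos (2 * pi * x))\<close>, which lies between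
  \<open>16 * q * x\<^sup>2\<close> and \<open>4 * pi\<^sup>2 * q * x\<^sup>2\<close>; the constants 13 and 41 leave room for the remaining terms.
  Poisson summation itself is proved by comparing cosine coefficients.

  In dimension \<open>n\<close> the theta series of a translate of the integer lattice is a product of
  one-dimensional ones, so it is comparable to the unshifted series with an error governed by \<open>q\<close> times
  the squared distance to the translate (\<open>integer_lattice_theta_bounds\<close>). The lattice \<open>\<Lambda>\<close> is a finite
  disjoint union of such translates. Keeping only the one through the lattice point nearest to \<open>v\<close>
  gives the upper bound for the logarithm. Bounding each translate by the distance from \<open>v\<close> to \<open>\<Lambda>\<close>
  gives the lower bound, at the cost of the number of translates, which is at most
  \<open>1 / lattice_det \<Lambda>\<close> (\<open>index_times_det_le_1\<close>).
\<close>

section \<open>Cosine series and the Gaussian integral\<close>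

text \<open>
  Uniqueness of Fourier cosine series. On \<open>[-1/2, 1/2]\<close> an even function factors through
  \<open>cos (2 * pi * x)\<close>, so by the Weierstrass theorem it is a uniform limit of polynomials in
  \<open>cos (2 * pi * x)\<close>. Those are linear combinations of the functions \<open>cos (2 * pi * m * x)\<close>;
  hence \<open>D\<close> is orthogonal to its own approximations, and the integral of \<open>D\<^sup>2\<close> vanishes.
\<close>
lemma even_function_orthogonal_to_cosines_eq_0:
  fixes D :: "real \<Rightarrow> real"
  assumes cont: "continuous_on {-1/2..1/2} D"
    and even: "\<And>x. x \<in> {-1/2..1/2} \<Longrightarrow> D (- x) = D x"
    and orth: "\<And>m::nat. ((\<lambda>x. D x * cos (2 * pi * m * x)) has_integral 0) {-1/2..1/2}"
    and x: "x \<in> {-1/2..1/2}"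
  shows "D x = 0"
proof -
  let ?I = "{-1/2..1/2::real}"
  \<comment> \<open>The product-to-sum formula lowers the power \<open>j\<close> at the price of changing \<open>m\<close> by one.\<close>
  have pow: "((\<lambda>x. D x * (cos (2 * pi * x) ^ j * cos (2 * pi * m * x))) has_integral 0) ?I" for j m :: nat
  proof (induction j arbitrary: m)
    case 0
    then show ?case using orth[of m] by simp
  next
    case (Suc j)
    show ?case
    proof (cases m)
      case 0
      then show ?thesis using Suc.IH[of 1] by (simp add: mult_ac)
    next
      case (Suc m')
      have "D x * (cos (2 * pi * x) ^ Suc j * cos (2 * pi * m * x))
        = 1/2 * (D x * (cos (2 * pi * x) ^ j * cos (2 * pi * (m'+2::nat) * x)))
          + 1/2 * (D x * (cos (2 * pi * x) ^ j * cos (2 * pi * m' * x)))" for x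
      proof -
        have "cos (2 * pi * (m'+2::nat) * x) = cos (2 * pi * m * x + 2 * pi * x)"
          "cos (2 * pi * m' * x) = cos (2 * pi * m * x - 2 * pi * x)"
          by (auto simp: Suc algebra_simps)
        then show ?thesis
          unfolding cos_add cos_diff by (simp only:) (simp add: algebra_simps)
      qed
      then show ?thesis
        using has_integral_add[OF has_integral_mult_right[OF Suc.IH[of "m'+2"], of "1/2"]
            has_integral_mult_right[OF Suc.IH[of m'], of "1/2"]] by simp
    qed
  qed
  have poly: "((\<lambda>x. D x * g (cos (2 * pi * x))) has_integral 0) ?I"
    if gp: "real_polynomial_function g" for g :: "real \<Rightarrow> real"
  proof -
    obtain a n where g: "g = (\<lambda>x. \<Sum>i\<le>n. a i * x^i)"
      using gp unfolding real_polynomial_function_iff_sum by blast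
    have "((\<lambda>x. \<Sum>i\<le>n::nat. a i * (D x * (cos (2 * pi * x) ^ i * cos (2 * pi * (0::nat) * x))))
        has_integral (\<Sum>i\<le>n. a i * 0)) ?I"
      by (intro has_integral_sum has_integral_mult_right pow) auto
    then show ?thesis by (simp add: g sum_distrib_left mult_ac)
  qed
  define G where "G c = D (arccos c / (2 * pi))" for c
  have Gcos: "G (cos (2 * pi * x)) = D x" if "x \<in> ?I" for x
  proof -
    have "arccos (cos (2 * pi * x)) = \<bar>2 * pi * x\<bar>"
    proof -
      have "\<bar>2 * pi * x\<bar> = 2 * pi * \<bar>x\<bar>" by (simp add: abs_mult)
      moreover have "2 * pi * \<bar>x\<bar> \<le> 2 * pi * (1/2)"
        using that by (intro mult_left_mono) auto
      ultimately have "arccos (cos \<bar>2 * pi * x\<bar>) = \<bar>2 * pi * x\<bar>"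
        by (intro arccos_cos) auto
      then show ?thesis by (simp only: cos_abs_real)
    qed
    then have "arccos (cos (2 * pi * x)) / (2 * pi) = \<bar>x\<bar>"
      by (simp add: abs_mult)
    then show ?thesis using even[OF that] by (auto simp: G_def abs_if)
  qed
  have contG: "continuous_on {-1..1} G"
    unfolding G_def
  proof (rule continuous_on_compose2[OF cont])
    show "continuous_on {-1..1} (\<lambda>x. arccos x / (2 * pi))"
      by (intro continuous_intros continuous_on_arccos') auto
    show "(\<lambda>x. arccos x / (2 * pi)) ` {-1..1} \<subseteq> {-1/2..1/2}"
    proof safe
      fix c :: real assume "c \<in> {-1..1}"
      then have "0 \<le> arccos c" "arccos c \<le> pi" using arccos_bounded[of c] by auto
      then have "0 \<le> arccos c / (2 * pi)" "arccos c / (2 * pi) \<le> 1/2" by (auto simp: field_simps)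
      then show "arccos c / (2 * pi) \<in> {-1/2..1/2}" by simp
    qed
  qed
  obtain B where B: "\<And>x. x \<in> ?I \<Longrightarrow> \<bar>D x\<bar> \<le> B" "B > 0"
  proof -
    have "bounded (D ` ?I)"
      by (intro compact_imp_bounded compact_continuous_image cont) auto
    then obtain b where b: "b > 0" "\<And>y. y \<in> D ` ?I \<Longrightarrow> norm y \<le> b"
      unfolding bounded_pos by blast
    have "\<bar>D x\<bar> \<le> b" if "x \<in> ?I" for x
      using b(2)[OF imageI[OF that]] by simp
    then show ?thesis using that b(1) by blast
  qed
  define J where "J = integral ?I (\<lambda>x. D x * D x)"
  have J: "((\<lambda>x. D x * D x) has_integral J) ?I"
    unfolding J_def by (intro integrable_integral integrable_continuous_real continuous_intros cont)
  \<comment> \<open>One factor \<open>D x\<close> may be replaced by the approximation error without changing the integral \<open>J\<close>.\<close>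
  have "J \<le> 0 + e" if "e > 0" for e
  proof -
    have "e / B > 0" using that B by simp
    then obtain g where g: "real_polynomial_function g" "\<And>c. c \<in> {-1..1} \<Longrightarrow> \<bar>G c - g c\<bar> < e / B"
      using Stone_Weierstrass_real_polynomial_function[OF compact_Icc contG] by metis
    have lhs: "((\<lambda>x. D x * (D x - g (cos (2 * pi * x)))) has_integral J) ?I"
      using has_integral_diff[OF J poly[OF g(1)]] by (simp add: algebra_simps)
    have rhs: "((\<lambda>x. e) has_integral e) ?I"
      using has_integral_const_real[of e "-1/2" "1/2"] by simp
    have "D x * (D x - g (cos (2 * pi * x))) \<le> e" if "x \<in> ?I" for x
    proof -
      have "\<bar>D x - g (cos (2 * pi * x))\<bar> \<le> e / B"
        using g(2)[of "cos (2 * pi * x)"] Gcos[OF that] by auto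
      then have "\<bar>D x\<bar> * \<bar>D x - g (cos (2 * pi * x))\<bar> \<le> B * (e / B)"
        using B that by (intro mult_mono) auto
      then show ?thesis using B(2) by (simp flip: abs_mult)
    qed
    with has_integral_le[OF lhs rhs] show ?thesis by simp
  qed
  then have "J \<le> 0" by (rule field_le_epsilon)
  moreover have "J \<ge> 0" using has_integral_nonneg[OF J] by simp
  ultimately have "((\<lambda>x. D x * D x) has_integral 0) (cbox (-1/2) (1/2))" using J by simp
  moreover have "continuous_on (cbox (-1/2) (1/2)) (\<lambda>x. D x * D x)"
    using continuous_on_mult[OF cont cont] by simp
  ultimately have "D x * D x = 0"
    using x by (intro has_integral_0_cbox_imp_0[of "-1/2" "1/2" "\<lambda>x. D x * D x"]) auto
  then show ?thesis by simp
qed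

text \<open>
  The real part of the characteristic function of the standard normal distribution, after the
  substitution \<open>x = r * y\<close> with \<open>r\<^sup>2 = 2 * \<tau>\<close>.
\<close>
lemma gaussian_cosine_integral:
  assumes "\<tau> > 0"
  shows "has_bochner_integral lborel (\<lambda>x::real. exp (- \<tau> * x\<^sup>2) * cos (s * x))
     (sqrt (pi / \<tau>) * exp (- (s\<^sup>2 / (4 * \<tau>))))"
proof -
  define r where "r = sqrt (2 * \<tau>)"
  have r: "r > 0" "r\<^sup>2 = 2 * \<tau>" using assms by (auto simp: r_def)
  have std: "has_bochner_integral lborel (\<lambda>x. std_normal_density x * cos (t * x)) (exp (- (t\<^sup>2) / 2))" for t
  proof -
    have int: "integrable lborel (\<lambda>x. std_normal_density x * cos (t * x))"
    proof (rule Bochner_Integration.integrable_bound)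
      show "integrable lborel std_normal_density" by simp
      show "AE x in lborel. norm (std_normal_density x * cos (t * x)) \<le> norm (std_normal_density x)"
        by (auto simp: abs_mult mult_left_le)
    qed auto
    have "complex_of_real (exp (- (t\<^sup>2) / 2)) = (CLINT x|lborel. std_normal_density x *\<^sub>R iexp (t * x))"
      unfolding fun_cong[OF char_std_normal_distribution, symmetric] char_def
      by (rule integral_density) (auto simp: normal_density_nonneg)
    also have "Re \<dots> = (LINT x|lborel. std_normal_density x * cos (t * x))"
    proof -
      have "integrable lborel (\<lambda>x. std_normal_density x *\<^sub>R iexp (t * x))"
        by (rule Bochner_Integration.integrable_bound[of _ std_normal_density]) auto
      then show ?thesis by (subst integral_Re[symmetric]) (auto simp: Re_exp)
    qed
    finally show ?thesis using int by (simp add: has_bochner_integral_iff)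
  qed
  have "has_bochner_integral lborel (\<lambda>x. std_normal_density (0 + r * x) * cos ((s / r) * (0 + r * x)))
     (exp (- ((s / r)\<^sup>2) / 2) /\<^sub>R \<bar>r\<bar>)"
    using r by (intro lborel_has_bochner_integral_real_affine_iff[THEN iffD1] std) auto
  then have "has_bochner_integral lborel (\<lambda>x. sqrt (2 * pi) * (std_normal_density (0 + r * x) * cos ((s / r) * (0 + r * x))))
     (sqrt (2 * pi) * (exp (- ((s / r)\<^sup>2) / 2) /\<^sub>R \<bar>r\<bar>))"
    by (intro has_bochner_integral_mult_right) auto
  moreover have "sqrt (2 * pi) * (std_normal_density (0 + r * x) * cos ((s / r) * (0 + r * x)))
     = exp (- \<tau> * x\<^sup>2) * cos (s * x)" for x
    using r by (simp add: std_normal_density_def power_mult_distrib)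
  moreover have "sqrt (2 * pi) * (exp (- ((s / r)\<^sup>2) / 2) /\<^sub>R \<bar>r\<bar>) = sqrt (pi / \<tau>) * exp (- (s\<^sup>2 / (4 * \<tau>)))"
  proof -
    have "sqrt (2 * pi) / r = sqrt (pi / \<tau>)"
      by (simp add: r_def flip: real_sqrt_divide)
    moreover have "(s / r)\<^sup>2 / 2 = s\<^sup>2 / (4 * \<tau>)" using r by (simp add: power_divide)
    moreover have "a * (E /\<^sub>R \<bar>r\<bar>) = a / r * E" for a E :: real
      using r(1) by (simp add: field_simps)
    ultimately show ?thesis by (simp only: minus_divide_left[symmetric])
  qed
  ultimately show ?thesis by simp
qed

section \<open>The periodised Gaussian\<close>

definition periodic_gaussian :: "real \<Rightarrow> real \<Rightarrow> real" where
  "periodic_gaussian \<tau> x = (\<Sum>\<^sub>\<infinity>k::int. exp (- \<tau> * (of_int k - x)\<^sup>2))"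

lemma summable_on_power_nat_abs:
  fixes r :: real
  assumes "0 \<le> r" "r < 1"
  shows "(\<lambda>k::int. r ^ nat \<bar>k\<bar>) summable_on UNIV"
proof -
  have geo: "(\<lambda>n::nat. r ^ n) summable_on UNIV"
    using assms by (intro norm_summable_imp_summable_on) (auto intro: summable_geometric)
  have "(\<lambda>k::int. r ^ nat \<bar>k\<bar>) summable_on range int"
    using geo by (subst summable_on_reindex) (auto simp: o_def)
  moreover have "(\<lambda>k::int. r ^ nat \<bar>k\<bar>) summable_on range (\<lambda>n. - int n)"
    using geo by (subst summable_on_reindex) (auto simp: o_def inj_on_def)
  moreover have "range int \<union> range (\<lambda>n. - int n) = UNIV"
    by (metis (mono_tags, lifting) UNIV_eq_I Un_iff int_cases2 rangeI)
  ultimately show ?thesis by (metis summable_on_union)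
qed

text \<open>
  Since \<open>\<bar>k - x\<bar> \<ge> \<bar>k\<bar> / 2\<close> for integers \<open>k\<close>, this bound is uniform in \<open>x\<close>. It is the majorant
  behind every interchange of sum and integral for the periodised Gaussian.
\<close>
lemma gauss_term_le_power:
  fixes \<tau> x :: real
  assumes "\<tau> > 0" "x \<in> {-1/2..1/2}"
  shows "exp (- \<tau> * (of_int k - x)\<^sup>2) \<le> exp (- \<tau> / 4) ^ nat \<bar>k\<bar>"
proof -
  have "real_of_int \<bar>k\<bar> / 4 \<le> (of_int k - x)\<^sup>2"
  proof (cases "k = 0")
    case False
    then have k1: "real_of_int \<bar>k\<bar> \<ge> 1" by linarith
    then have "real_of_int \<bar>k\<bar> / 2 \<le> \<bar>of_int k - x\<bar>"
      using assms(2) unfolding atLeastAtMost_iff by linarith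
    then have "(real_of_int \<bar>k\<bar> / 2)\<^sup>2 \<le> \<bar>of_int k - x\<bar>\<^sup>2" using k1 by (intro power_mono) auto
    moreover have "real_of_int \<bar>k\<bar> * 1 \<le> real_of_int \<bar>k\<bar> * real_of_int \<bar>k\<bar>"
      using k1 by (intro mult_left_mono) auto
    ultimately show ?thesis by (simp add: power2_eq_square)
  qed simp
  then have "- \<tau> * (of_int k - x)\<^sup>2 \<le> - \<tau> * (real_of_int \<bar>k\<bar> / 4)"
    using assms(1) by simp
  also have "\<dots> = real (nat \<bar>k\<bar>) * (- \<tau> / 4)" by simp
  finally show ?thesis by (simp only: exp_of_nat_mult[symmetric] exp_le_cancel_iff)
qed

lemma summable_gauss_power:
  assumes "\<tau> > (0::real)"
  shows "(\<lambda>k::int. exp (- \<tau> / 4) ^ nat \<bar>k\<bar>) summable_on UNIV"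
  using assms by (intro summable_on_power_nat_abs) auto

lemma periodic_gaussian_shift:
  "((\<lambda>k::int. exp (- \<tau> * (of_int k - (x + of_int j))\<^sup>2)) has_sum S) UNIV
     \<longleftrightarrow> ((\<lambda>k::int. exp (- \<tau> * (of_int k - x)\<^sup>2)) has_sum S) UNIV"
  by (rule has_sum_reindex_bij_witness[of _ "\<lambda>k. k + j" "\<lambda>k. k - j"])
    (auto simp: algebra_simps)

lemma periodic_gaussian_add_int: "periodic_gaussian \<tau> (x + of_int j) = periodic_gaussian \<tau> x"
  unfolding periodic_gaussian_def
  by (rule infsum_reindex_bij_witness[of _ "\<lambda>k. k + j" "\<lambda>k. k - j"]) (auto simp: algebra_simps)

lemma summable_gauss:
  fixes \<tau> x :: real
  assumes "\<tau> > 0"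
  shows "(\<lambda>k::int. exp (- \<tau> * (of_int k - x)\<^sup>2)) summable_on UNIV"
proof -
  \<comment> \<open>The majorant only covers \<open>[-1/2, 1/2]\<close>; other points are moved there by periodicity.\<close>
  define y where "y = x - of_int (round x)"
  have "\<bar>y\<bar> \<le> 1/2"
    using of_int_round_abs_le[of x] by (simp add: y_def abs_minus_commute)
  then have y: "y \<in> {-1/2..1/2}" by (auto simp: abs_le_iff)
  have "(\<lambda>k::int. exp (- \<tau> * (of_int k - y)\<^sup>2)) summable_on UNIV"
    by (rule summable_on_comparison_test[OF summable_gauss_power[OF assms]])
      (use gauss_term_le_power[OF assms y] in auto)
  then show ?thesis
    using periodic_gaussian_shift[of \<tau> y "round x"] by (auto simp: summable_on_def y_def)
qed

lemma filterlim_symmetric_int_interval: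
  "filterlim (\<lambda>N::nat. {- int N..int N}) (finite_subsets_at_top UNIV) sequentially"
  unfolding filterlim_finite_subsets_at_top
proof safe
  fix X :: "int set" assume X: "finite X"
  have "X \<subseteq> {- int N..int N}" if "N \<ge> (\<Sum>k\<in>X. nat \<bar>k\<bar>)" for N
  proof
    fix k assume "k \<in> X"
    then have "nat \<bar>k\<bar> \<le> (\<Sum>k\<in>X. nat \<bar>k\<bar>)" using X by (intro member_le_sum) auto
    then show "k \<in> {- int N..int N}" using that by auto
  qed
  then show "\<forall>\<^sub>F N::nat in sequentially. finite {- int N..int N} \<and> X \<subseteq> {- int N..int N} \<and> {- int N..int N} \<subseteq> UNIV"
    unfolding eventually_sequentially by blast
qed

lemma uniform_limit_periodic_gaussian:
  assumes "\<tau> > 0" "\<And>x. \<bar>c x\<bar> \<le> 1"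
  shows "uniform_limit {-1/2..1/2} (\<lambda>N x. \<Sum>k\<in>{- int N..int N}. exp (- \<tau> * (of_int k - x)\<^sup>2) * c x)
     (\<lambda>x. periodic_gaussian \<tau> x * c x) sequentially"
proof -
  have "uniform_limit {-1/2..1/2} (\<lambda>X x. \<Sum>k\<in>X. exp (- \<tau> * (of_int k - x)\<^sup>2) * c x)
     (\<lambda>x. periodic_gaussian \<tau> x * c x) (finite_subsets_at_top UNIV)"
  proof (rule Weierstrass_m_test_general'[OF _ _ summable_gauss_power[OF assms(1)]])
    fix k :: int and x :: real assume x: "x \<in> {-1/2..1/2}"
    have "exp (- \<tau> * (of_int k - x)\<^sup>2) * \<bar>c x\<bar> \<le> exp (- \<tau> / 4) ^ nat \<bar>k\<bar> * 1"
      using gauss_term_le_power[OF assms(1) x] assms(2) by (intro mult_mono) auto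
    then show "norm (exp (- \<tau> * (of_int k - x)\<^sup>2) * c x) \<le> exp (- \<tau> / 4) ^ nat \<bar>k\<bar>"
      by (simp add: abs_mult)
  next
    fix x show "((\<lambda>k::int. exp (- \<tau> * (of_int k - x)\<^sup>2) * c x) has_sum periodic_gaussian \<tau> x * c x) UNIV"
      unfolding periodic_gaussian_def by (intro has_sum_cmult_left has_sum_infsum summable_gauss assms(1))
  qed
  from filterlim_compose[OF this filterlim_symmetric_int_interval] show ?thesis .
qed

text \<open>
  Unfolding: integrating all translates of \<open>F\<close> over one period integrates \<open>F\<close> over the
  union of the translated periods.
\<close>
lemma has_integral_sum_translates:
  fixes F :: "real \<Rightarrow> real"
  assumes "continuous_on UNIV F"
  shows "((\<lambda>x. \<Sum>k\<in>{- int N..int N}. F (x - of_int k)) has_integral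
     integral {-(real N + 1/2)..real N + 1/2} F) {-1/2..1/2}"
proof (induction N)
  case 0
  have "F integrable_on {-1/2..1/2}"
    by (intro integrable_continuous_real continuous_on_subset[OF assms]) auto
  then show ?case by (simp add: has_integral_integral)
next
  case (Suc N)
  have int: "F integrable_on {a..b}" for a b
    by (intro integrable_continuous_real continuous_on_subset[OF assms]) auto
  have shift: "((\<lambda>x. F (x + c)) has_integral integral {-1/2+c..1/2+c} F) {-1/2..1/2}" for c
  proof -
    have "(F has_integral integral {-1/2+c..1/2+c} F) (cbox (-1/2+c) (1/2+c))"
      using int by (simp add: has_integral_integral)
    from has_integral_affinity[OF this, of 1 c] show ?thesis by simp
  qed
  let ?n = "real N"
  have "{- int (Suc N)..int (Suc N)} = insert (- int (Suc N)) (insert (int (Suc N)) {- int N..int N})"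
    by auto
  then have eq: "(\<Sum>k\<in>{- int (Suc N)..int (Suc N)}. F (x - of_int k))
      = F (x + (?n + 1)) + (F (x + (- ?n - 1)) + (\<Sum>k\<in>{- int N..int N}. F (x - of_int k)))" for x
    by (simp add: algebra_simps)
  have "((\<lambda>x. F (x + (?n + 1)) + (F (x + (- ?n - 1)) + (\<Sum>k\<in>{- int N..int N}. F (x - of_int k))))
      has_integral (integral {-1/2+(?n+1)..1/2+(?n+1)} F
        + (integral {-1/2+(- ?n - 1)..1/2+(- ?n - 1)} F + integral {-(?n + 1/2)..?n + 1/2} F))) {-1/2..1/2}"
    by (intro has_integral_add shift Suc.IH)
  moreover have "integral {-1/2+(?n+1)..1/2+(?n+1)} F
        + (integral {-1/2+(- ?n - 1)..1/2+(- ?n - 1)} F + integral {-(?n + 1/2)..?n + 1/2} F)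
      = integral {-(real (Suc N) + 1/2)..real (Suc N) + 1/2} F"
  proof -
    have "integral {-(?n + 3/2)..-(?n + 1/2)} F + integral {-(?n + 1/2)..?n + 1/2} F
        = integral {-(?n + 3/2)..?n + 1/2} F"
      "integral {-(?n + 3/2)..?n + 1/2} F + integral {?n + 1/2..?n + 3/2} F
        = integral {-(?n + 3/2)..?n + 3/2} F"
      by (intro Henstock_Kurzweil_Integration.integral_combine int; simp)+
    then show ?thesis by (simp add: algebra_simps)
  qed
  ultimately show ?case by (simp only: eq)
qed

lemma integral_symmetric_intervals_tendsto:
  fixes F :: "real \<Rightarrow> real"
  assumes "has_bochner_integral lborel F I"
  shows "(\<lambda>N. integral {-(real N + 1/2)..real N + 1/2} F) \<longlonglongrightarrow> I"
proof (rule LIMSEQ_I)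
  fix e :: real assume e: "e > 0"
  have "(F has_integral I) UNIV"
    using assms has_integral_integral_lborel by (metis has_bochner_integral_iff)
  then obtain B where B: "\<And>a b. ball 0 B \<subseteq> cbox a b \<Longrightarrow> norm (integral (cbox a b) F - I) < e"
    using e unfolding has_integral_alt' if_P[OF UNIV_I] by metis
  show "\<exists>n0. \<forall>n\<ge>n0. norm (integral {-(real n + 1/2)..real n + 1/2} F - I) < e"
  proof (intro exI allI impI)
    fix n :: nat assume "nat \<lceil>B\<rceil> \<le> n"
    then have "B \<le> real n" by linarith
    then have "ball 0 B \<subseteq> cbox (-(real n + 1/2)) (real n + 1/2)" by (auto simp: dist_real_def)
    from B[OF this] show "norm (integral {-(real n + 1/2)..real n + 1/2} F - I) < e" by simp
  qed
qed

text \<open>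
  The Fourier coefficients of the periodised Gaussian are values of the Fourier transform of the
  Gaussian itself, because \<open>cos (2 * pi * m * x)\<close> is invariant under integer translations and the
  integrals over the translated periods add up to an integral over the line.
\<close>
lemma periodic_gaussian_cosine_coefficient:
  fixes m :: nat
  assumes "\<tau> > 0"
  shows "((\<lambda>x. periodic_gaussian \<tau> x * cos (2 * pi * m * x)) has_integral
     sqrt (pi / \<tau>) * exp (- (pi\<^sup>2 / \<tau>)) ^ m\<^sup>2) {-1/2..1/2}"
proof -
  define F where "F y = exp (- \<tau> * y\<^sup>2) * cos (2 * pi * m * y)" for y
  have F: "F (x - of_int k) = exp (- \<tau> * (of_int k - x)\<^sup>2) * cos (2 * pi * m * x)" for x k
  proof -
    have "cos (2 * pi * m * (x - of_int k)) = cos (2 * pi * m * x - 2 * pi * of_int (int m * k))"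
      by (simp add: algebra_simps)
    also have "\<dots> = cos (2 * pi * m * x)"
      unfolding cos_diff using cos_int_2pin[of "int m * k"] sin_int_2pin[of "int m * k"]
      by (simp only: mult.assoc)
    finally show ?thesis by (simp add: F_def power2_commute)
  qed
  have cont: "continuous_on UNIV F" unfolding F_def by (intro continuous_intros)
  have "uniform_limit {-1/2..1/2} (\<lambda>N x. \<Sum>k\<in>{- int N..int N}. F (x - of_int k))
     (\<lambda>x. periodic_gaussian \<tau> x * cos (2 * pi * m * x)) sequentially"
    unfolding F by (rule uniform_limit_periodic_gaussian[OF assms]) auto
  moreover have "continuous_on {-1/2..1/2} (\<lambda>x. \<Sum>k\<in>{- int N..int N}. F (x - of_int k))" for N
    by (intro continuous_intros continuous_on_compose2[OF cont]) auto
  ultimately obtain I J where IJ: "\<And>N. ((\<lambda>x. \<Sum>k\<in>{- int N..int N}. F (x - of_int k)) has_integral I N) {-1/2..1/2}"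
    "((\<lambda>x. periodic_gaussian \<tau> x * cos (2 * pi * m * x)) has_integral J) {-1/2..1/2}" "I \<longlonglongrightarrow> J"
    by (rule uniform_limit_integral[OF _ _ sequentially_bot]) (rule that)
  have "I N = integral {-(real N + 1/2)..real N + 1/2} F" for N
    using has_integral_unique[OF IJ(1) has_integral_sum_translates[OF cont]] .
  then have I: "I = (\<lambda>N. integral {-(real N + 1/2)..real N + 1/2} F)" by auto
  have "has_bochner_integral lborel F (sqrt (pi / \<tau>) * exp (- ((2 * pi * m)\<^sup>2 / (4 * \<tau>))))"
    unfolding F_def by (rule gaussian_cosine_integral[OF assms])
  then have "I \<longlonglongrightarrow> sqrt (pi / \<tau>) * exp (- ((2 * pi * m)\<^sup>2 / (4 * \<tau>)))"
    unfolding I by (rule integral_symmetric_intervals_tendsto)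
  with IJ(3) have "J = sqrt (pi / \<tau>) * exp (- ((2 * pi * m)\<^sup>2 / (4 * \<tau>)))"
    by (rule LIMSEQ_unique)
  also have "- ((2 * pi * m)\<^sup>2 / (4 * \<tau>)) = real (m\<^sup>2) * (- (pi\<^sup>2 / \<tau>))"
    by (simp add: power_mult_distrib)
  finally have "J = sqrt (pi / \<tau>) * exp (- (pi\<^sup>2 / \<tau>)) ^ m\<^sup>2"
    by (simp only: exp_of_nat_mult)
  with IJ(2) show ?thesis by simp
qed

section \<open>Poisson summation and the one-dimensional bounds\<close>

definition dual_coeff :: "real \<Rightarrow> nat \<Rightarrow> real" where
  "dual_coeff q k = (if k = 0 then 1 else 2 * q ^ k\<^sup>2)"

text \<open>
  The theta series \<open>1 + 2 * q * cos (2 * pi * x) + 2 * q ^ 4 * cos (4 * pi * x) + \<dots>\<close>,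
  that is, the Jacobi theta function \<open>\<theta>\<^sub>3\<close> at the argument \<open>pi * x\<close>.
\<close>
definition dual_sum :: "real \<Rightarrow> real \<Rightarrow> real" where
  "dual_sum q x = (\<Sum>k. dual_coeff q k * cos (2 * pi * k * x))"

lemma dual_coeff_nonneg: "0 \<le> q \<Longrightarrow> 0 \<le> dual_coeff q k"
  by (simp add: dual_coeff_def)

lemma dual_coeff_le:
  assumes "0 \<le> q" "q < 1"
  shows "dual_coeff q k \<le> 2 * q ^ k"
proof -
  have "k \<le> k\<^sup>2" by (simp add: power2_eq_square)
  then have "q ^ k\<^sup>2 \<le> q ^ k" using assms by (intro power_decreasing) auto
  then show ?thesis using assms by (auto simp: dual_coeff_def)
qed

lemma summable_dual_coeff_mult:
  assumes "0 \<le> q" "q < 1" "\<And>k. \<bar>c k\<bar> \<le> 1"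
  shows "summable (\<lambda>k. dual_coeff q k * c k)"
proof (rule summable_comparison_test')
  show "summable (\<lambda>k. 2 * q ^ k)" using assms by (intro summable_mult summable_geometric) auto
  show "norm (dual_coeff q k * c k) \<le> 2 * q ^ k" if "k \<ge> 0" for k
  proof -
    have "dual_coeff q k * \<bar>c k\<bar> \<le> 2 * q ^ k * 1"
      using dual_coeff_le[OF assms(1,2)] dual_coeff_nonneg[OF assms(1)] assms by (intro mult_mono) auto
    then show ?thesis using dual_coeff_nonneg[OF assms(1), of k] by (simp add: abs_mult)
  qed
qed

lemma uniform_limit_dual_sum:
  assumes "0 \<le> q" "q < 1" "\<And>x. \<bar>c x\<bar> \<le> 1"
  shows "uniform_limit A (\<lambda>n x. \<Sum>k<n. dual_coeff q k * cos (2 * pi * k * x) * c x)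
     (\<lambda>x. dual_sum q x * c x) sequentially"
proof -
  have "uniform_limit A (\<lambda>n x. \<Sum>k<n. dual_coeff q k * cos (2 * pi * k * x) * c x)
     (\<lambda>x. \<Sum>k. dual_coeff q k * cos (2 * pi * k * x) * c x) sequentially"
  proof (rule Weierstrass_m_test)
    show "summable (\<lambda>k. 2 * q ^ k)" using assms by (intro summable_mult summable_geometric) auto
    fix k :: nat and x :: real
    have "dual_coeff q k * (\<bar>cos (2 * pi * k * x)\<bar> * \<bar>c x\<bar>) \<le> 2 * q ^ k * (1 * 1)"
      using dual_coeff_le[OF assms(1,2)] dual_coeff_nonneg[OF assms(1)] assms
      by (intro mult_mono) auto
    then show "norm (dual_coeff q k * cos (2 * pi * k * x) * c x) \<le> 2 * q ^ k"
      using dual_coeff_nonneg[OF assms(1), of k] by (simp add: abs_mult mult.assoc)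
  qed
  moreover have "(\<Sum>k. dual_coeff q k * cos (2 * pi * k * x) * c x) = dual_sum q x * c x" for x
    unfolding dual_sum_def using assms
    by (intro suminf_mult2[symmetric] summable_dual_coeff_mult) auto
  ultimately show ?thesis by simp
qed

lemma cosine_integral:
  fixes j :: int
  shows "((\<lambda>x. cos (2 * pi * j * x)) has_integral (if j = 0 then 1 else 0)) {-1/2..1/2}"
proof (cases "j = 0")
  case True
  then show ?thesis using has_integral_const_real[of 1 "-1/2" "1/2"] by simp
next
  case False
  have "((\<lambda>x. cos (2 * pi * j * x)) has_integral
     sin (2 * pi * j * (1/2)) / (2 * pi * j) - sin (2 * pi * j * (-1/2)) / (2 * pi * j)) {-1/2..1/2}"
    using False
    by (intro fundamental_theorem_of_calculus)
       (auto intro!: derivative_eq_intros simp flip: has_real_derivative_iff_has_vector_derivative)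
  moreover have "sin (2 * pi * j * (1/2)) = 0" "sin (2 * pi * j * (-1/2)) = 0"
    using sin_int_times_real[of j] by (auto simp: mult.commute sin_zero_iff_int2)
  ultimately show ?thesis using False by simp
qed

lemma cosine_product_integral:
  fixes k m :: nat
  shows "((\<lambda>x. dual_coeff q k * cos (2 * pi * k * x) * cos (2 * pi * m * x)) has_integral
     (if k = m then q ^ m\<^sup>2 else 0)) {-1/2..1/2}"
proof -
  have "((\<lambda>x. dual_coeff q k / 2 * (cos (2 * pi * (int k - int m) * x) + cos (2 * pi * (int k + int m) * x)))
     has_integral dual_coeff q k / 2 * ((if int k - int m = 0 then 1 else 0) + (if int k + int m = 0 then 1 else 0)))
     {-1/2..1/2}"
    by (intro has_integral_mult_right has_integral_add cosine_integral)
  moreover have "dual_coeff q k / 2 * (cos (2 * pi * (int k - int m) * x) + cos (2 * pi * (int k + int m) * x))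
      = dual_coeff q k * cos (2 * pi * k * x) * cos (2 * pi * m * x)" for x
    by (simp add: cos_times_cos algebra_simps)
  moreover have "dual_coeff q k / 2 * ((if int k - int m = 0 then 1 else 0) + (if int k + int m = 0 then 1 else 0))
      = (if k = m then q ^ m\<^sup>2 else 0)"
    by (auto simp: dual_coeff_def)
  ultimately show ?thesis by (simp only:)
qed

lemma dual_sum_cosine_coefficient:
  fixes m :: nat
  assumes "0 \<le> q" "q < 1"
  shows "((\<lambda>x. dual_sum q x * cos (2 * pi * m * x)) has_integral q ^ m\<^sup>2) {-1/2..1/2}"
proof -
  let ?f = "\<lambda>n x. \<Sum>k<n. dual_coeff q k * cos (2 * pi * k * x) * cos (2 * pi * m * x)"
  have "uniform_limit {-1/2..1/2} ?f (\<lambda>x. dual_sum q x * cos (2 * pi * m * x)) sequentially"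
    by (rule uniform_limit_dual_sum[OF assms]) auto
  moreover have "continuous_on {-1/2..1/2} (?f n)" for n
    by (intro continuous_intros)
  ultimately obtain I J where IJ: "\<And>n. (?f n has_integral I n) {-1/2..1/2}"
    "((\<lambda>x. dual_sum q x * cos (2 * pi * m * x)) has_integral J) {-1/2..1/2}" "I \<longlonglongrightarrow> J"
    by (rule uniform_limit_integral[OF _ _ sequentially_bot]) (rule that)
  have "(?f n has_integral (\<Sum>k<n. if k = m then q ^ m\<^sup>2 else 0)) {-1/2..1/2}" for n
    by (intro has_integral_sum cosine_product_integral) auto
  then have I: "I n = (\<Sum>k<n. if k = m then q ^ m\<^sup>2 else 0)" for n
    using IJ(1) has_integral_unique by blast
  have "\<forall>\<^sub>F n in sequentially. I n = q ^ m\<^sup>2"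
    using eventually_gt_at_top[of m] by eventually_elim (simp add: I)
  then have "I \<longlonglongrightarrow> q ^ m\<^sup>2" by (rule tendsto_eventually)
  with IJ show ?thesis using LIMSEQ_unique by blast
qed

text \<open>
  Poisson summation for the Gaussian: both sides are continuous and even and have the same cosine
  coefficients. After this transformation the small parameter is \<open>exp (- (pi\<^sup>2 / \<tau>))\<close>, so that for
  \<open>\<tau> \<le> 1\<close> the first two terms of the series determine everything up to a tiny error.
\<close>
lemma periodic_gaussian_eq_dual_sum:
  assumes \<tau>: "\<tau> > 0" and x: "x \<in> {-1/2..1/2}"
  shows "periodic_gaussian \<tau> x = sqrt (pi / \<tau>) * dual_sum (exp (- (pi\<^sup>2 / \<tau>))) x"
proof -
  define q where "q = exp (- (pi\<^sup>2 / \<tau>))"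
  have q: "0 \<le> q" "q < 1" using \<tau> by (auto simp: q_def)
  let ?I = "{-1/2..1/2::real}"
  let ?D = "\<lambda>x. periodic_gaussian \<tau> x - sqrt (pi / \<tau>) * dual_sum q x"
  have "?D x = 0"
  proof (rule even_function_orthogonal_to_cosines_eq_0[OF _ _ _ x])
    have "continuous_on ?I (\<lambda>x. periodic_gaussian \<tau> x * 1)"
      by (rule uniform_limit_theorem[OF _ uniform_limit_periodic_gaussian[OF \<tau>]])
        (auto intro!: always_eventually continuous_intros)
    moreover have "continuous_on ?I (\<lambda>x. dual_sum q x * 1)"
      by (rule uniform_limit_theorem[OF _ uniform_limit_dual_sum[OF q]])
        (auto intro!: always_eventually continuous_intros)
    ultimately show "continuous_on ?I ?D" by (intro continuous_intros) simp_all
  next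
    fix y :: real
    have "periodic_gaussian \<tau> (- y) = periodic_gaussian \<tau> y"
      unfolding periodic_gaussian_def
      by (rule infsum_reindex_bij_witness[of _ uminus uminus]) (auto simp: power2_eq_square algebra_simps)
    then show "?D (- y) = ?D y" by (simp add: dual_sum_def)
  next
    fix m :: nat
    show "((\<lambda>x. ?D x * cos (2 * pi * m * x)) has_integral 0) ?I"
      using has_integral_diff[OF periodic_gaussian_cosine_coefficient[OF \<tau>, of m]
        has_integral_mult_right[OF dual_sum_cosine_coefficient[OF q, of m], of "sqrt (pi / \<tau>)"]]
      by (simp add: q_def algebra_simps)
  qed
  then show ?thesis by (simp add: q_def)
qed

lemma one_minus_cos_le: "1 - cos t \<le> t\<^sup>2 / (2::real)"
proof -
  have "cos t = 1 - 2 * (sin (t / 2))\<^sup>2" using cos_double_sin[of "t/2"] by simp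
  moreover have "\<bar>sin (t / 2)\<bar>\<^sup>2 \<le> \<bar>t / 2\<bar>\<^sup>2" by (intro power_mono abs_sin_x_le_abs_x) auto
  ultimately show ?thesis by (simp add: power_divide)
qed

text \<open>
  The sine is concave on \<open>[0, pi]\<close>, so it lies above its chord from \<open>0\<close> to \<open>pi / 2\<close>; then
  \<open>1 - cos (2 * t) = 2 * (sin t)\<^sup>2\<close>.
\<close>
lemma one_minus_cos_ge:
  assumes "\<bar>x\<bar> \<le> 1/2"
  shows "8 * x\<^sup>2 \<le> 1 - cos (2 * pi * x)"
proof -
  have "concave_on {0..pi} sin"
    by (rule f''_le0_imp_concave[where f' = cos and f'' = "\<lambda>x. - sin x"])
      (auto intro!: derivative_eq_intros sin_ge_zero)
  from concave_onD[OF this, of "2 * \<bar>x\<bar>" 0 "pi / 2"] assms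
 have "2 * \<bar>x\<bar> \<le> sin (pi * \<bar>x\<bar>)" by (simp add: mult_ac)
  then have "(2 * \<bar>x\<bar>)\<^sup>2 \<le> (sin (pi * \<bar>x\<bar>))\<^sup>2" by (intro power_mono) auto
  moreover have "cos (2 * pi * x) = 1 - 2 * (sin (pi * \<bar>x\<bar>))\<^sup>2"
    using cos_double_sin[of "pi * x"] by (auto simp: abs_if mult_ac)
  ultimately show ?thesis by (simp add: power_mult_distrib)
qed

lemma dual_sum_diff:
  assumes "0 \<le> q" "q < 1"
  shows "(\<lambda>k. dual_coeff q k * (1 - cos (2 * pi * k * x))) sums (dual_sum q 0 - dual_sum q x)"
proof -
  have "(\<lambda>k. dual_coeff q k * cos (2 * pi * k * y)) sums dual_sum q y" for y
    unfolding dual_sum_def using assms by (intro summable_sums summable_dual_coeff_mult) auto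
  from sums_diff[OF this[of 0] this[of x]] show ?thesis by (simp add: algebra_simps)
qed

text \<open>
  All terms of the difference series are nonnegative, and the term of index 1 alone is
  \<open>2 * q * (1 - cos (2 * pi * x))\<close>.
\<close>
lemma dual_sum_drop_ge:
  assumes "0 \<le> q" "q < 1" "\<bar>x\<bar> \<le> 1/2"
  shows "16 * q * x\<^sup>2 \<le> dual_sum q 0 - dual_sum q x"
proof -
  have "2 * q * (8 * x\<^sup>2) \<le> 2 * q * (1 - cos (2 * pi * x))"
    using assms one_minus_cos_ge by (intro mult_left_mono) auto
  also have "\<dots> = (\<Sum>k\<in>{1}. dual_coeff q k * (1 - cos (2 * pi * real k * x)))"
    by (simp add: dual_coeff_def)
  also have "\<dots> \<le> dual_sum q 0 - dual_sum q x"
    unfolding sums_unique[OF dual_sum_diff[OF assms(1,2), of x]] using dual_coeff_nonneg[OF assms(1)]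
    by (intro sum_le_suminf sums_summable[OF dual_sum_diff[OF assms(1,2)]]) auto
  finally show ?thesis by simp
qed

text \<open>
  The term of index \<open>k\<close> is at most \<open>2 * q ^ k * (2 * pi\<^sup>2 * k\<^sup>2 * x\<^sup>2)\<close>. With \<open>k\<^sup>2 \<le> 4 ^ (k - 1)\<close>
  the factor \<open>k\<^sup>2\<close> is absorbed into a geometric series.
\<close>
lemma dual_sum_drop_le:
  assumes "0 \<le> q" "q < 1/4"
  shows "dual_sum q 0 - dual_sum q x \<le> 4 * pi\<^sup>2 * (q / (1 - 4 * q)) * x\<^sup>2"
proof -
  have sq: "(Suc k)\<^sup>2 \<le> 4 ^ k" for k
  proof (induction k)
    case (Suc k)
    have "(Suc (Suc k))\<^sup>2 \<le> 4 * (Suc k)\<^sup>2" by (simp add: power2_eq_square)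
    with Suc show ?case by simp
  qed simp
  have bound: "dual_coeff q (Suc k) * (1 - cos (2 * pi * Suc k * x)) \<le> (4 * q) ^ k * (4 * pi\<^sup>2 * q * x\<^sup>2)" for k
  proof -
    have "dual_coeff q (Suc k) * (1 - cos (2 * pi * Suc k * x)) \<le> (2 * q ^ Suc k) * ((2 * pi * Suc k * x)\<^sup>2 / 2)"
      using assms dual_coeff_le[of q "Suc k"] one_minus_cos_le by (intro mult_mono) auto
    also have "\<dots> = q ^ Suc k * (4 * pi\<^sup>2 * x\<^sup>2) * real ((Suc k)\<^sup>2)"
      by (simp only: power_mult_distrib of_nat_power) simp
    also have "\<dots> \<le> q ^ Suc k * (4 * pi\<^sup>2 * x\<^sup>2) * real (4 ^ k)"
      using assms sq by (intro mult_left_mono of_nat_mono) auto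
    also have "\<dots> = (4 * q) ^ k * (4 * pi\<^sup>2 * q * x\<^sup>2)"
      by (simp add: power_mult_distrib)
    finally show ?thesis .
  qed
  have "(\<lambda>k. dual_coeff q (Suc k) * (1 - cos (2 * pi * Suc k * x))) sums (dual_sum q 0 - dual_sum q x)"
    using dual_sum_diff[of q x] assms by (subst sums_Suc_iff) simp
  moreover have "(\<lambda>k. (4 * q) ^ k * (4 * pi\<^sup>2 * q * x\<^sup>2)) sums (1 / (1 - 4 * q) * (4 * pi\<^sup>2 * q * x\<^sup>2))"
    using assms by (intro sums_mult2 geometric_sums) auto
  ultimately have "dual_sum q 0 - dual_sum q x \<le> 1 / (1 - 4 * q) * (4 * pi\<^sup>2 * q * x\<^sup>2)"
    by (rule sums_le[OF bound])
  then show ?thesis by (simp add: mult_ac)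
qed

lemma dual_sum_near_1:
  assumes "0 \<le> q" "q < 1"
  shows "\<bar>dual_sum q x - 1\<bar> \<le> 2 * q / (1 - q)"
proof -
  let ?f = "\<lambda>k. dual_coeff q k * cos (2 * pi * k * x)"
  have sum: "summable ?f" using assms by (intro summable_dual_coeff_mult) auto
  then have "?f sums dual_sum q x" unfolding dual_sum_def by (rule summable_sums)
  then have s: "(\<lambda>k. ?f (Suc k)) sums (dual_sum q x - 1)"
    by (subst sums_Suc_iff) (simp add: dual_coeff_def)
  have g: "(\<lambda>k. q ^ k * (2 * q)) sums (1 / (1 - q) * (2 * q))"
    using assms by (intro sums_mult2 geometric_sums) auto
  have "\<bar>?f (Suc k)\<bar> \<le> q ^ k * (2 * q)" for k
  proof -
    have "dual_coeff q (Suc k) * \<bar>cos (2 * pi * Suc k * x)\<bar> \<le> 2 * q ^ Suc k * 1"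
      using assms by (intro mult_mono dual_coeff_le) (auto simp del: power_Suc)
    then show ?thesis using dual_coeff_nonneg[OF assms(1)] by (simp add: abs_mult mult_ac)
  qed
  then have "norm (\<Sum>k. ?f (Suc k)) \<le> (\<Sum>k. q ^ k * (2 * q))"
    by (intro norm_suminf_le) (auto intro: sums_summable[OF g])
  then show ?thesis using sums_unique[OF s] sums_unique[OF g] by simp
qed

lemma dual_sum_between:
  assumes "0 \<le> q" "q \<le> 1 / 1000"
  shows "dual_sum q x \<ge> 997 / 1000" "dual_sum q x \<le> 1003 / 1000"
proof -
  have "2 * q / (1 - q) \<le> 3 / 1000" using assms by (simp add: divide_le_eq)
  moreover have "\<bar>dual_sum q x - 1\<bar> \<le> 2 * q / (1 - q)" using assms by (intro dual_sum_near_1) auto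
  ultimately have "\<bar>dual_sum q x - 1\<bar> \<le> 3 / 1000" by linarith
  then show "dual_sum q x \<ge> 997 / 1000" "dual_sum q x \<le> 1003 / 1000" by linarith+
qed

text \<open>
  From \<open>ln (a / b) \<ge> (a - b) / a\<close>: the drop \<open>a - b\<close> is at least \<open>16 * q * x\<^sup>2\<close>, and \<open>a\<close> is close to 1.
\<close>
lemma dual_sum_ln_ge:
  assumes "0 \<le> q" "q \<le> 1 / 1000" "\<bar>x\<bar> \<le> 1/2"
  shows "13 * q * x\<^sup>2 \<le> ln (dual_sum q 0 / dual_sum q x)"
proof -
  let ?a = "dual_sum q 0" and ?b = "dual_sum q x"
  have ab: "?a > 0" "?b > 0" using dual_sum_between[OF assms(1,2), of 0] dual_sum_between[OF assms(1,2), of x] by linarith+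
  have "13 * q * x\<^sup>2 * ?a \<le> 13 * q * x\<^sup>2 * (16 / 13)"
    using dual_sum_between(2)[OF assms(1,2), of 0] assms by (intro mult_left_mono) auto
  also have "\<dots> \<le> ?a - ?b" using dual_sum_drop_ge[of q x] assms by simp
  finally have "13 * q * x\<^sup>2 \<le> (?a - ?b) / ?a" using ab by (simp add: pos_le_divide_eq)
  also have "\<dots> = 1 - ?b / ?a" using ab by (simp add: field_simps)
  also have "\<dots> \<le> - ln (?b / ?a)" using ln_le_minus_one[of "?b / ?a"] ab by simp
  also have "\<dots> = ln (?a / ?b)" using ab by (simp add: ln_div)
  finally show ?thesis .
qed

text \<open>
  From \<open>ln (a / b) \<le> (a - b) / b\<close>: the drop is essentially at most \<open>4 * pi\<^sup>2 * q * x\<^sup>2\<close>, where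
  \<open>4 * pi\<^sup>2 < 39.489\<close>, and the margin up to 41 pays for the tail of the series and for \<open>b\<close> being
  slightly less than 1.
\<close>
lemma dual_sum_ln_le:
  assumes "0 \<le> q" "q \<le> 1 / 1000"
  shows "ln (dual_sum q 0 / dual_sum q x) \<le> 41 * q * x\<^sup>2"
proof -
  let ?a = "dual_sum q 0" and ?b = "dual_sum q x"
  have ab: "?a > 0" "?b \<ge> 997 / 1000" "?b > 0"
    using dual_sum_between[OF assms(1,2), of 0] dual_sum_between[OF assms(1,2), of x] by linarith+
  have "pi\<^sup>2 \<le> 3.142\<^sup>2" using pi_approx by (intro power_mono) auto
  then have pi2: "4 * pi\<^sup>2 \<le> 39.489" by (simp add: power2_eq_square)
  have "q / (1 - 4 * q) \<le> q * (250 / 249)"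
  proof -
    have "q * 249 \<le> q * (250 * (1 - 4 * q))" using assms by (intro mult_left_mono) auto
    then show ?thesis using assms by (simp add: divide_le_eq mult_ac)
  qed
  then have "4 * pi\<^sup>2 * (q / (1 - 4 * q)) * x\<^sup>2 \<le> 39.489 * (q * (250 / 249)) * x\<^sup>2"
    using pi2 assms by (intro mult_mono) auto
  also have "\<dots> \<le> 41 * q * x\<^sup>2 * (997 / 1000)"
    using mult_nonneg_nonneg[OF assms(1) zero_le_power2[of x]] by simp
  also have "\<dots> \<le> 41 * q * x\<^sup>2 * ?b" using ab assms by (intro mult_left_mono) auto
  finally have "?a - ?b \<le> 41 * q * x\<^sup>2 * ?b" using dual_sum_drop_le[of q x] assms by linarith
  then have "(?a - ?b) / ?b \<le> 41 * q * x\<^sup>2" using ab by (simp add: pos_divide_le_eq)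
  moreover have "ln (?a / ?b) \<le> ?a / ?b - 1" using ab by (intro ln_le_minus_one) auto
  moreover have "?a / ?b - 1 = (?a - ?b) / ?b" using ab by (simp add: field_simps)
  ultimately show ?thesis by linarith
qed

lemma exp_pi_squared_bound:
  assumes "0 < \<tau>" "\<tau> \<le> 1"
  shows "exp (- (pi\<^sup>2 / \<tau>)) \<le> 1 / 1000"
proof -
  have "(3::real)\<^sup>2 \<le> pi\<^sup>2" using pi_approx by (intro power_mono) auto
  also have "\<dots> \<le> pi\<^sup>2 / \<tau>" using assms by (simp add: le_divide_eq mult_left_le)
  finally have "9 \<le> pi\<^sup>2 / \<tau>" by simp
  have "(3 / 2 :: real) ^ 18 \<le> exp (1 / 2) ^ 18"
    using exp_ge_add_one_self[of "1/2::real"] by (intro power_mono) auto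
  also have "\<dots> = exp (9::real)" by (simp flip: exp_of_nat_mult)
  also have "\<dots> \<le> exp (pi\<^sup>2 / \<tau>)" using \<open>9 \<le> _\<close> by simp
  finally have "1000 \<le> exp (pi\<^sup>2 / \<tau>)" by (simp add: power_divide)
  then show ?thesis by (simp add: exp_minus field_simps)
qed

text \<open>
  The one-dimensional case of the theorem. The factor \<open>sqrt (pi / \<tau>)\<close> from Poisson summation
  cancels, since only the ratio of two values of the periodised Gaussian matters.
\<close>
lemma periodic_gaussian_bounds:
  assumes "0 < \<tau>" "\<tau> \<le> 1" "x \<in> {-1/2..1/2}"
  shows "periodic_gaussian \<tau> x \<le> periodic_gaussian \<tau> 0 * exp (- (13 * exp (- (pi\<^sup>2 / \<tau>)) * x\<^sup>2))"
    and "periodic_gaussian \<tau> 0 * exp (- (41 * exp (- (pi\<^sup>2 / \<tau>)) * x\<^sup>2)) \<le> periodic_gaussian \<tau> x"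
proof -
  define q where "q = exp (- (pi\<^sup>2 / \<tau>))"
  have q: "0 \<le> q" "q \<le> 1 / 1000" using exp_pi_squared_bound[OF assms(1,2)] by (auto simp: q_def)
  have x: "\<bar>x\<bar> \<le> 1/2" using assms(3) by (auto simp: abs_le_iff)
  let ?C = "sqrt (pi / \<tau>)"
  have C: "?C > 0" using assms by simp
  have eq: "periodic_gaussian \<tau> y = ?C * dual_sum q y" if "y \<in> {-1/2..1/2}" for y
    using periodic_gaussian_eq_dual_sum[OF assms(1) that] by (simp add: q_def)
  have pos: "dual_sum q y > 0" for y using dual_sum_between[OF q, of y] by linarith
  have ratio: "dual_sum q x = dual_sum q 0 * exp (- ln (dual_sum q 0 / dual_sum q x))"
    using pos[of 0] pos[of x] by (simp add: exp_minus)
  have "dual_sum q x \<le> dual_sum q 0 * exp (- (13 * q * x\<^sup>2))"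
    using dual_sum_ln_ge[OF q x] pos[of 0] by (subst ratio) (intro mult_left_mono; simp)
  moreover have "dual_sum q 0 * exp (- (41 * q * x\<^sup>2)) \<le> dual_sum q x"
    using dual_sum_ln_le[OF q, of x] pos[of 0] by (subst ratio) (intro mult_left_mono; simp)
  ultimately show "periodic_gaussian \<tau> x \<le> periodic_gaussian \<tau> 0 * exp (- (13 * exp (- (pi\<^sup>2 / \<tau>)) * x\<^sup>2))"
    "periodic_gaussian \<tau> 0 * exp (- (41 * exp (- (pi\<^sup>2 / \<tau>)) * x\<^sup>2)) \<le> periodic_gaussian \<tau> x"
    using eq[of 0] eq[OF assms(3)] C by (simp_all flip: q_def add: mult.assoc)
qed

section \<open>Theta series of translates of the integer lattice\<close>

lemma periodic_gaussian_pos: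
  assumes "\<tau> > 0"
  shows "periodic_gaussian \<tau> x > 0"
proof -
  have "(\<Sum>k\<in>{0::int}. exp (- \<tau> * (of_int k - x)\<^sup>2)) \<le> periodic_gaussian \<tau> x"
    unfolding periodic_gaussian_def by (intro finite_sum_le_infsum summable_gauss assms) auto
  moreover have "(0::real) < (\<Sum>k\<in>{0::int}. exp (- \<tau> * (of_int k - x)\<^sup>2))" by simp
  ultimately show ?thesis by linarith
qed

lemma exp_norm_eq_prod:
  fixes x :: "real ^ 'n::finite"
  shows "exp (a * (norm x)\<^sup>2) = (\<Prod>i\<in>UNIV. exp (a * (x $ i)\<^sup>2))"
proof -
  have "(norm x)\<^sup>2 = (\<Sum>i\<in>UNIV. (x $ i)\<^sup>2)"
    unfolding power2_norm_eq_inner inner_vec_def by (simp add: power2_eq_square)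
  then show ?thesis by (simp add: sum_distrib_left exp_sum)
qed

text \<open>
  The Gaussian factors over the coordinates, and so does a sum over all integer vectors.
\<close>
lemma integer_lattice_theta:
  fixes w :: "real ^ 'n::finite"
  assumes "\<tau> > 0"
  shows "lattice_theta integer_lattice \<tau> w = (\<Prod>i\<in>UNIV. periodic_gaussian \<tau> (w $ i))"
    and "(\<lambda>x. exp (- \<tau> * (norm (x - w))\<^sup>2)) summable_on integer_lattice"
proof -
  let ?e = "\<lambda>g :: 'n \<Rightarrow> int. (\<chi> i. of_int (g i)) :: real ^ 'n"
  have inj: "inj ?e" by (auto simp: inj_def vec_eq_iff)
  have img: "integer_lattice = range ?e"
  proof safe
    fix x :: "real ^ 'n" assume "x \<in> integer_lattice"
    then have "?e (\<lambda>i. \<lfloor>x $ i\<rfloor>) = x"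
      by (auto simp: integer_lattice_def vec_eq_iff elim!: Ints_cases)
    then show "x \<in> range ?e" by (metis rangeI)
  qed (auto simp: integer_lattice_def)
  have "lattice_theta integer_lattice \<tau> w
      = (\<Sum>\<^sub>\<infinity>g\<in>Pi\<^sub>E UNIV (\<lambda>_. UNIV). \<Prod>i\<in>UNIV. exp (- \<tau> * (of_int (g i) - w $ i)\<^sup>2))"
    unfolding lattice_theta_def img infsum_reindex[OF inj] exp_norm_eq_prod o_def
    by (simp add: PiE_def)
  also have "\<dots> = (\<Prod>i\<in>UNIV. periodic_gaussian \<tau> (w $ i))"
    unfolding periodic_gaussian_def using summable_gauss[OF assms] by (intro infsum_prod_PiE_abs) auto
  finally show eq: "lattice_theta integer_lattice \<tau> w = (\<Prod>i\<in>UNIV. periodic_gaussian \<tau> (w $ i))" .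
  \<comment> \<open>A non-summable family has sum 0, but this sum is positive.\<close>
  have "lattice_theta integer_lattice \<tau> w \<noteq> 0"
    unfolding eq using periodic_gaussian_pos[OF assms] by (auto simp: less_le)
  then show "(\<lambda>x. exp (- \<tau> * (norm (x - w))\<^sup>2)) summable_on integer_lattice"
    unfolding lattice_theta_def using infsum_not_exists by blast
qed

lemma integer_theta_eq:
  "integer_theta TYPE('n::finite) \<tau> = lattice_theta (integer_lattice :: (real ^ 'n) set) \<tau> 0"
  by (simp add: integer_theta_def lattice_theta_def)

lemma integer_theta_pos: "\<tau> > 0 \<Longrightarrow> integer_theta TYPE('n::finite) \<tau> > 0"
  unfolding integer_theta_eq using periodic_gaussian_pos by (simp add: integer_lattice_theta(1) prod_pos)

text \<open>
  The coordinatewise bounds multiply up, once \<open>w\<close> is reduced modulo the integer lattice to a vector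
  with coordinates in \<open>[-1/2, 1/2]\<close>. Here \<open>z\<close> is the integer vector nearest to \<open>w\<close>.
\<close>
lemma integer_lattice_theta_bounds:
  fixes w :: "real ^ 'n::finite"
  assumes "0 < \<tau>" "\<tau> \<le> 1"
  obtains z where "z \<in> integer_lattice" "norm (w - z) \<le> norm w"
    "lattice_theta integer_lattice \<tau> w
       \<le> integer_theta TYPE('n) \<tau> * exp (- (13 * exp (- (pi\<^sup>2 / \<tau>))) * (norm (w - z))\<^sup>2)"
    "integer_theta TYPE('n) \<tau> * exp (- (41 * exp (- (pi\<^sup>2 / \<tau>))) * (norm (w - z))\<^sup>2)
       \<le> lattice_theta integer_lattice \<tau> w"
proof (rule that)
  define z :: "real ^ 'n" where "z = (\<chi> i. of_int (round (w $ i)))"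
  show "z \<in> integer_lattice" by (simp add: z_def integer_lattice_def)
  show "norm (w - z) \<le> norm w"
    using round_diff_minimal[of _ 0] by (intro norm_le_componentwise_cart) (simp add: z_def)
  have small: "(w - z) $ i \<in> {-1/2..1/2}" for i
    using of_int_round_abs_le[of "w $ i"]
    unfolding z_def vector_minus_component vec_lambda_beta atLeastAtMost_iff by linarith
  note bounds = periodic_gaussian_bounds[OF assms small]
  have period: "periodic_gaussian \<tau> (w $ i) = periodic_gaussian \<tau> ((w - z) $ i)" for i
    using periodic_gaussian_add_int[of \<tau> "(w - z) $ i" "round (w $ i)"] by (simp add: z_def)
  have prod: "integer_theta TYPE('n) \<tau> * exp (a * (norm (w - z))\<^sup>2)
      = (\<Prod>i\<in>UNIV. periodic_gaussian \<tau> 0 * exp (a * ((w - z) $ i)\<^sup>2))" for a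
    unfolding integer_theta_eq integer_lattice_theta(1)[OF assms(1)] exp_norm_eq_prod
    by (simp add: prod.distrib)
  show "lattice_theta integer_lattice \<tau> w
       \<le> integer_theta TYPE('n) \<tau> * exp (- (13 * exp (- (pi\<^sup>2 / \<tau>))) * (norm (w - z))\<^sup>2)"
    unfolding prod integer_lattice_theta(1)[OF assms(1)] period
    using bounds(1) less_imp_le[OF periodic_gaussian_pos[OF assms(1)]]
    by (intro prod_mono) (simp only: minus_mult_left simp_thms)
  show "integer_theta TYPE('n) \<tau> * exp (- (41 * exp (- (pi\<^sup>2 / \<tau>))) * (norm (w - z))\<^sup>2)
       \<le> lattice_theta integer_lattice \<tau> w"
    unfolding prod integer_lattice_theta(1)[OF assms(1)] period
    using bounds(2) less_imp_le[OF periodic_gaussian_pos[OF assms(1)]]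
    by (intro prod_mono conjI mult_nonneg_nonneg) simp_all
qed

lemma
  fixes v c :: "real ^ 'n::finite"
  assumes "\<tau> > 0"
  shows lattice_theta_coset:
      "lattice_theta ((+) c ` integer_lattice) \<tau> v = lattice_theta integer_lattice \<tau> (v - c)"
    and summable_on_coset:
      "(\<lambda>u. exp (- \<tau> * (norm (u - v))\<^sup>2)) summable_on ((+) c ` integer_lattice)"
proof -
  have eq: "(\<lambda>u. exp (- \<tau> * (norm (u - v))\<^sup>2)) \<circ> (+) c = (\<lambda>x. exp (- \<tau> * (norm (x - (v - c)))\<^sup>2))"
    by (auto simp: algebra_simps)
  show "lattice_theta ((+) c ` integer_lattice) \<tau> v = lattice_theta integer_lattice \<tau> (v - c)"
    unfolding lattice_theta_def by (subst infsum_reindex) (simp_all only: eq inj_on_add)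
  show "(\<lambda>u. exp (- \<tau> * (norm (u - v))\<^sup>2)) summable_on ((+) c ` integer_lattice)"
    by (subst summable_on_reindex) (simp_all only: eq inj_on_add integer_lattice_theta(2)[OF assms])
qed

section \<open>Lattices containing the integer lattice\<close>

lemma euclidean_lattice_add:
  assumes "euclidean_lattice \<Lambda>" "x \<in> \<Lambda>" "y \<in> \<Lambda>"
  shows "x + y \<in> \<Lambda>"
  using assms unfolding euclidean_lattice_def by (metis diff_minus_eq_add diff_0)

lemma euclidean_lattice_int_combination:
  assumes L: "euclidean_lattice \<Lambda>" and b: "\<And>i. i \<in> S \<Longrightarrow> b i \<in> \<Lambda>"
  shows "(\<Sum>i\<in>S. of_int (c i) *\<^sub>R b i) \<in> \<Lambda>"
proof -
  have zero: "0 \<in> \<Lambda>" using L by (simp add: euclidean_lattice_def)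
  have mult: "of_int m *\<^sub>R x \<in> \<Lambda>" if x: "x \<in> \<Lambda>" for m x
  proof (induction m rule: int_induct[where k = 0])
    case (step1 i)
    then show ?case using euclidean_lattice_add[OF L _ x] by (simp add: scaleR_add_left)
  next
    case (step2 i)
    then show ?case using L x by (simp add: scaleR_diff_left euclidean_lattice_def)
  qed (simp add: zero)
  show ?thesis using b
    by (induction S rule: infinite_finite_induct) (auto simp: zero mult euclidean_lattice_add[OF L])
qed

text \<open>
  For a lattice containing the integer lattice, these points represent each coset of the integer
  lattice exactly once, so that their number is the index.
\<close>
definition unit_cell_points :: "(real ^ 'n) set \<Rightarrow> (real ^ 'n) set" where
  "unit_cell_points \<Lambda> = \<Lambda> \<inter> {x. \<forall>i. 0 \<le> x $ i \<and> x $ i < 1}"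

lemma finite_unit_cell_points:
  fixes \<Lambda> :: "(real ^ 'n::finite) set"
  assumes "euclidean_lattice \<Lambda>"
  shows "finite (unit_cell_points \<Lambda>)"
proof -
  have ud: "uniform_discrete (unit_cell_points \<Lambda>)"
    using euclidean_lattice_uniform_discrete[OF assms] uniform_discrete_subset
    by (auto simp: unit_cell_points_def)
  have "bounded (unit_cell_points \<Lambda>)"
    by (rule bounded_subset[OF bounded_cbox[of 0 1]])
      (auto simp: unit_cell_points_def mem_box_cart less_imp_le)
  then show ?thesis using ud uniform_discrete_finite_iff by blast
qed

lemma
  fixes \<Lambda> :: "(real ^ 'n::finite) set"
  assumes L: "euclidean_lattice \<Lambda>" and Z: "integer_lattice \<subseteq> \<Lambda>"
  shows frac_mem_unit_cell_points: "u \<in> \<Lambda> \<Longrightarrow> (\<chi> i. frac (u $ i)) \<in> unit_cell_points \<Lambda>"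
    and lattice_eq_Union_cosets: "\<Lambda> = (\<Union>c\<in>unit_cell_points \<Lambda>. (+) c ` integer_lattice)"
    and cosets_disjoint: "c \<in> unit_cell_points \<Lambda> \<Longrightarrow> c' \<in> unit_cell_points \<Lambda> \<Longrightarrow> c \<noteq> c' \<Longrightarrow>
       (+) c ` integer_lattice \<inter> (+) c' ` integer_lattice = {}"
proof -
  have split: "u = (\<chi> i. frac (u $ i)) + (\<chi> i. of_int \<lfloor>u $ i\<rfloor>)" for u :: "real ^ 'n"
    by (simp add: vec_eq_iff frac_def)
  have int: "(\<chi> i. of_int \<lfloor>u $ i\<rfloor>) \<in> integer_lattice" for u :: "real ^ 'n"
    by (simp add: integer_lattice_def)
  show frac: "(\<chi> i. frac (u $ i)) \<in> unit_cell_points \<Lambda>" if "u \<in> \<Lambda>" for u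
  proof -
    have "u - (\<chi> i. of_int \<lfloor>u $ i\<rfloor>) \<in> \<Lambda>"
      using L that Z int by (auto simp: euclidean_lattice_def)
    moreover have "u - (\<chi> i. of_int \<lfloor>u $ i\<rfloor>) = (\<chi> i. frac (u $ i))"
      by (simp add: vec_eq_iff frac_def)
    ultimately show ?thesis by (simp add: unit_cell_points_def frac_lt_1)
  qed
  show "\<Lambda> = (\<Union>c\<in>unit_cell_points \<Lambda>. (+) c ` integer_lattice)"
  proof safe
    fix u assume "u \<in> \<Lambda>"
    then show "u \<in> (\<Union>c\<in>unit_cell_points \<Lambda>. (+) c ` integer_lattice)"
      using split[of u] int[of u] frac by blast
  next
    fix c z assume "c \<in> unit_cell_points \<Lambda>" "z \<in> (integer_lattice :: (real ^ 'n) set)"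
    then show "c + z \<in> \<Lambda>"
      using euclidean_lattice_add[OF L] Z by (auto simp: unit_cell_points_def)
  qed
  show "(+) c ` integer_lattice \<inter> (+) c' ` integer_lattice = {}"
    if c: "c \<in> unit_cell_points \<Lambda>" "c' \<in> unit_cell_points \<Lambda>" "c \<noteq> c'" for c c'
  proof (rule ccontr)
    assume "\<not> ?thesis"
    then obtain z z' where z: "z \<in> integer_lattice" "z' \<in> integer_lattice" "c + z = c' + z'" by auto
    have "c $ i = c' $ i" for i
    proof -
      have "c $ i - c' $ i = z' $ i - z $ i"
        using arg_cong[OF z(3), of "\<lambda>x. x $ i"] by simp
      moreover have "z' $ i - z $ i \<in> \<int>" using z by (auto simp: integer_lattice_def)
      ultimately have "c $ i - c' $ i \<in> \<int>" by simp
      moreover have "\<bar>c $ i - c' $ i\<bar> < 1"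
      proof -
        have "0 \<le> c $ i" "c $ i < 1" "0 \<le> c' $ i" "c' $ i < 1"
          using c by (auto simp: unit_cell_points_def)
        then show ?thesis by linarith
      qed
      ultimately show ?thesis using Ints_nonzero_abs_less1 by force
    qed
    then show False using c(3) by (simp add: vec_eq_iff)
  qed
qed

lemma det_nonzero_imp_independent_rows:
  fixes b :: "'n::finite \<Rightarrow> real ^ 'n"
  assumes "det (\<chi> i. b i) \<noteq> 0"
  shows "inj b" "independent (range b)"
proof -
  let ?A = "(\<chi> i. b i) :: real ^ 'n ^ 'n"
  have r: "row i ?A = b i" for i by (simp add: row_def)
  show "inj b"
    using assms det_identical_rows[of _ _ ?A] by (auto simp: inj_def r)
  have "rows ?A = range b" by (auto simp: rows_def r)
  then show "independent (range b)"
    using assms det_dependent_rows[of ?A] by (auto simp: dependent_vec_eq)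
qed

lemma gram_det_eq_square:
  fixes b :: "'n::finite \<Rightarrow> real ^ 'n"
  shows "det (gram_matrix b) = (det (\<chi> i. b i))\<^sup>2"
proof -
  have "gram_matrix b = (\<chi> i. b i) ** transpose (\<chi> i. b i)"
    by (simp add: gram_matrix_def matrix_matrix_mult_def transpose_def vec_eq_iff inner_vec_def)
  then show ?thesis by (simp add: det_mul power2_eq_square)
qed


text \<open>
  A Hermite-type basis is built by adding coordinates to \<open>S\<close> one at a time, starting from the
  standard basis. For a new coordinate \<open>k\<close>, the \<open>k\<close>-th coordinates of lattice vectors supported on
  \<open>insert k S\<close> are exactly the multiples of a least positive one \<open>h\<close>, and \<open>h = 1 / m\<close> for an
  integer \<open>m\<close> because \<open>axis k 1\<close> is such a vector. Replacing \<open>axis k 1\<close> by a vector \<open>u\<close> with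
  \<open>u $ k = h\<close> divides the determinant by \<open>m\<close>. The number of lattice points in the unit cell that are
  supported on the coordinate set grows at most by the factor \<open>m\<close>, since modulo multiples of \<open>u\<close> the
  coordinate \<open>k\<close> can be cleared. So the product of this number with the determinant never exceeds 1.
\<close>
lemma exists_triangular_lattice_basis:
  fixes \<Lambda> :: "(real ^ 'n::finite) set" and S :: "'n set"
  assumes L: "euclidean_lattice \<Lambda>" and Z: "integer_lattice \<subseteq> \<Lambda>"
  shows "\<exists>b :: 'n \<Rightarrow> real ^ 'n. (\<forall>i. b i \<in> \<Lambda>) \<and> (\<forall>i. i \<notin> S \<longrightarrow> b i = axis i 1)
     \<and> (\<forall>i\<in>S. \<forall>j. j \<notin> S \<longrightarrow> b i $ j = 0) \<and> 0 < det (\<chi> i. b i)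
     \<and> (\<forall>w\<in>\<Lambda>. (\<forall>j. j \<notin> S \<longrightarrow> w $ j = 0) \<longrightarrow> (\<exists>c. w = (\<Sum>i\<in>S. of_int (c i) *\<^sub>R b i)))
     \<and> real (card {w \<in> unit_cell_points \<Lambda>. \<forall>j. j \<notin> S \<longrightarrow> w $ j = 0}) * det (\<chi> i. b i) \<le> 1"
  using finite[of S]
proof (induction S rule: finite_induct)
  case empty
  have "(\<chi> i. axis i 1) = (mat 1 :: real ^ 'n ^ 'n)"
    by (simp add: vec_eq_iff mat_def axis_def)
  then have "det (\<chi> i. (axis i 1 :: real ^ 'n)) = 1" by simp
  moreover have "axis i 1 \<in> \<Lambda>" for i
    using Z by (auto simp: integer_lattice_def axis_def)
  moreover have "w = 0" if "\<forall>j. w $ j = 0" for w :: "real ^ 'n"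
    using that by (simp add: vec_eq_iff)
  moreover have "{w \<in> unit_cell_points \<Lambda>. \<forall>j. w $ j = 0} \<subseteq> {0}" by (auto simp: vec_eq_iff)
  then have "card {w \<in> unit_cell_points \<Lambda>. \<forall>j. w $ j = 0} \<le> 1"
    using card_mono[of "{0}" "{w \<in> unit_cell_points \<Lambda>. \<forall>j. w $ j = 0}"] by simp
  ultimately show ?case
    by (intro exI[of _ "\<lambda>i. axis i 1"]) auto
next
  case (insert k S)
  let ?R = "unit_cell_points \<Lambda>"
  obtain b :: "'n \<Rightarrow> real ^ 'n" where b: "\<forall>i. b i \<in> \<Lambda>" "\<forall>i. i \<notin> S \<longrightarrow> b i = axis i 1"
    and bS: "\<forall>i\<in>S. \<forall>j. j \<notin> S \<longrightarrow> b i $ j = 0" and pos: "0 < det (\<chi> i. b i)"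
    and span: "\<forall>w\<in>\<Lambda>. (\<forall>j. j \<notin> S \<longrightarrow> w $ j = 0) \<longrightarrow> (\<exists>c. w = (\<Sum>i\<in>S. of_int (c i) *\<^sub>R b i))"
    and count: "real (card {w \<in> ?R. \<forall>j. j \<notin> S \<longrightarrow> w $ j = 0}) * det (\<chi> i. b i) \<le> 1"
    using insert.IH by (elim exE conjE) (rule that)
  define T where "T = {w \<in> \<Lambda>. \<forall>j. j \<notin> insert k S \<longrightarrow> w $ j = 0}"
  have diff: "x - of_int j *\<^sub>R y \<in> T" if "x \<in> T" "y \<in> T" for x y j
  proof -
    have "of_int j *\<^sub>R y \<in> \<Lambda>"
      using euclidean_lattice_int_combination[OF L, of "{()}" "\<lambda>_. y" "\<lambda>_. j"] that by (simp add: T_def)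
    then show ?thesis using L that by (auto simp: T_def euclidean_lattice_def)
  qed
  have axisT: "axis k 1 \<in> T"
    using Z by (auto simp: T_def integer_lattice_def axis_def)
  \<comment> \<open>The finitely many candidates include \<open>axis k 1\<close>, which forces \<open>h \<le> 1\<close>.\<close>
  define A where "A = {w \<in> insert (axis k 1) ?R. w \<in> T \<and> 0 < w $ k}"
  have "finite A" "A \<noteq> {}"
    using axisT finite_unit_cell_points[OF L] by (auto simp: A_def axis_def)
  then obtain u where u: "u \<in> A" "\<And>y. y \<in> A \<Longrightarrow> u $ k \<le> y $ k"
    using arg_min_if_finite[of A "\<lambda>w. w $ k"] by (metis not_less)
  define h where "h = u $ k"
  have uT: "u \<in> T" and h: "0 < h" "h \<le> 1"
    using u(1) u(2)[of "axis k 1"] axisT by (auto simp: A_def h_def axis_def)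
  \<comment> \<open>Division with remainder: a nonzero remainder would be a smaller positive coordinate.\<close>
  have step: "w $ k = of_int \<lfloor>w $ k / h\<rfloor> * h" if w: "w \<in> T" for w
  proof (rule ccontr)
    assume neq: "\<not> ?thesis"
    define w' where "w' = w - of_int \<lfloor>w $ k / h\<rfloor> *\<^sub>R u"
    have w'T: "w' \<in> T" unfolding w'_def by (rule diff[OF w uT])
    have w'k: "w' $ k = frac (w $ k / h) * h"
      using h by (simp add: w'_def h_def[symmetric] frac_def left_diff_distrib)
    have "w' $ k \<noteq> 0" using neq by (simp add: w'_def h_def)
    then have "0 < w' $ k" using w'k h by (metis frac_ge_0 less_le mult_nonneg_nonneg)
    moreover have lt: "w' $ k < h" unfolding w'k using frac_lt_1[of "w $ k / h"] h by simp
    ultimately have fr: "frac (w' $ k) = w' $ k" using h by (simp add: frac_eq)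
    let ?v = "(\<chi> i. frac (w' $ i)) :: real ^ 'n"
    have "?v \<in> ?R" using frac_mem_unit_cell_points[OF L Z] w'T by (simp add: T_def)
    moreover from this have "?v \<in> T" using w'T by (auto simp: T_def unit_cell_points_def)
    ultimately have "?v \<in> A" using fr \<open>0 < w' $ k\<close> by (simp add: A_def)
    from u(2)[OF this] fr lt show False by (simp add: h_def)
  qed
  define m where "m = nat \<lfloor>1 / h\<rfloor>"
  have m: "real m * h = 1"
    using step[OF axisT] h by (simp add: m_def axis_def of_nat_nat)
  define b' where "b' = b(k := u)"
  have det': "det (\<chi> i. b' i) = h * det (\<chi> i. b i)"
  proof -
    let ?A = "(\<chi> i. b i) :: real ^ 'n ^ 'n"
    obtain x where "transpose ?A *v x = u"
      using cramer[of "transpose ?A" _ u] pos by (auto simp: det_transpose)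
    then have x: "u = (\<Sum>i\<in>UNIV. x $ i *\<^sub>R b i)"
      unfolding matrix_mult_sum by (simp add: column_def transpose_def scalar_mult_eq_scaleR)
    have "b i $ k = (if i = k then 1 else 0)" for i
      using bS b(2) insert.hyps(2) by (cases "i \<in> S") (auto simp: axis_def)
    then have "(\<Sum>i\<in>UNIV. x $ i * b i $ k) = (\<Sum>i\<in>UNIV. if i = k then x $ i else 0)"
      by (intro sum.cong refl) auto
    then have "h = x $ k" unfolding h_def by (subst x) simp
    moreover have "(\<chi> i. b' i) = (\<chi> i. if i = k then \<Sum>i\<in>UNIV. x $ i *s row i ?A else row i ?A)"
      by (simp add: b'_def x[symmetric] row_def scalar_mult_eq_scaleR fun_upd_def vec_eq_iff)
    ultimately show ?thesis using cramer_lemma_transpose[of k x ?A] by simp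
  qed
  have span': "\<exists>c. w = (\<Sum>i\<in>insert k S. of_int (c i) *\<^sub>R b' i)" if w: "w \<in> T" for w
  proof -
    define j where "j = \<lfloor>w $ k / h\<rfloor>"
    have wj: "w - of_int j *\<^sub>R u \<in> T" by (rule diff[OF w uT])
    moreover have "(w - of_int j *\<^sub>R u) $ k = 0" using step[OF w] by (simp add: j_def h_def)
    ultimately have "(w - of_int j *\<^sub>R u) $ i = 0" if "i \<notin> S" for i
      using that by (cases "i = k") (auto simp: T_def)
    then obtain c where c: "w - of_int j *\<^sub>R u = (\<Sum>i\<in>S. of_int (c i) *\<^sub>R b i)"
      using bspec[OF span, of "w - of_int j *\<^sub>R u"] wj by (auto simp: T_def)
    have "(\<Sum>i\<in>S. of_int ((c(k := j)) i) *\<^sub>R b' i) = (\<Sum>i\<in>S. of_int (c i) *\<^sub>R b i)"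
      using insert.hyps(2) by (intro sum.cong) (auto simp: b'_def)
    then have "w = (\<Sum>i\<in>insert k S. of_int ((c(k := j)) i) *\<^sub>R b' i)"
      using insert.hyps c by (simp add: b'_def algebra_simps)
    then show ?thesis by blast
  qed
  let ?RS = "{w \<in> ?R. \<forall>j. j \<notin> S \<longrightarrow> w $ j = 0}" and ?RS' = "{w \<in> ?R. \<forall>j. j \<notin> insert k S \<longrightarrow> w $ j = 0}"
  have "card ?RS' \<le> card (?RS \<times> {0..<int m})"
  proof (rule card_inj_on_le)
    define j where "j w = \<lfloor>w $ k / h\<rfloor>" for w :: "real ^ 'n"
    \<comment> \<open>A point is determined by its multiple of \<open>u\<close> and the reduced rest, as points of the unit cell that
      differ by an integer vector agree.\<close>
    define \<phi> where "\<phi> w = (\<chi> i. frac ((w - of_int (j w) *\<^sub>R u) $ i), j w)" for w :: "real ^ 'n"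
    have RT: "w \<in> T" if "w \<in> ?RS'" for w using that by (auto simp: T_def unit_cell_points_def)
    show "inj_on \<phi> ?RS'"
    proof (rule inj_onI)
      fix w w' assume w: "w \<in> ?RS'" "w' \<in> ?RS'" and eq: "\<phi> w = \<phi> w'"
      have "w $ i = w' $ i" for i
      proof -
        have "frac ((w - of_int (j w) *\<^sub>R u) $ i) = frac ((w' - of_int (j w) *\<^sub>R u) $ i)"
          using eq by (auto simp: \<phi>_def vec_eq_iff)
        then have "w $ i - w' $ i = of_int (\<lfloor>(w - of_int (j w) *\<^sub>R u) $ i\<rfloor> - \<lfloor>(w' - of_int (j w) *\<^sub>R u) $ i\<rfloor>)"
          by (simp add: frac_def)
        then have "w $ i - w' $ i \<in> \<int>" by (metis Ints_of_int)
        moreover have "0 \<le> w $ i" "w $ i < 1" "0 \<le> w' $ i" "w' $ i < 1"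
          using w by (auto simp: unit_cell_points_def)
        then have "\<bar>w $ i - w' $ i\<bar> < 1" by linarith
        ultimately show ?thesis using Ints_nonzero_abs_less1 by force
      qed
      then show "w = w'" by (simp add: vec_eq_iff)
    qed
    show "\<phi> ` ?RS' \<subseteq> ?RS \<times> {0..<int m}"
    proof (rule image_subsetI)
      fix w assume w: "w \<in> ?RS'"
      have wj: "w - of_int (j w) *\<^sub>R u \<in> T" by (rule diff[OF RT[OF w] uT])
      moreover have zero: "(w - of_int (j w) *\<^sub>R u) $ k = 0" using step[OF RT[OF w]] by (simp add: j_def h_def)
      ultimately have "(w - of_int (j w) *\<^sub>R u) $ i = 0" if "i \<notin> S" for i
        using that by (cases "i = k") (auto simp: T_def)
      moreover have "(\<chi> i. frac ((w - of_int (j w) *\<^sub>R u) $ i)) \<in> ?R"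
        by (rule frac_mem_unit_cell_points[OF L Z]) (use wj in \<open>unfold T_def, blast\<close>)
      ultimately have "(\<chi> i. frac ((w - of_int (j w) *\<^sub>R u) $ i)) \<in> ?RS" by simp
      moreover have "j w \<in> {0..<int m}"
      proof -
        have "0 \<le> w $ k" "w $ k < 1" using w by (auto simp: unit_cell_points_def)
        then have "of_int (j w) * h < real m * h" "0 \<le> j w"
          using step[OF RT[OF w]] m h by (auto simp: j_def)
        then show ?thesis using h by simp
      qed
      ultimately show "\<phi> w \<in> ?RS \<times> {0..<int m}" by (simp add: \<phi>_def)
    qed
  qed (use finite_unit_cell_points[OF L] in auto)
  then have "real (card ?RS') * (h * det (\<chi> i. b i)) \<le> real (card ?RS * m) * (h * det (\<chi> i. b i))"
    using h pos by (intro mult_right_mono of_nat_mono) (auto simp: card_cartesian_product)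
  also have "\<dots> = real (card ?RS) * det (\<chi> i. b i) * (real m * h)" by simp
  also have "\<dots> \<le> 1" using count m by simp
  finally have count': "real (card ?RS') * det (\<chi> i. b' i) \<le> 1" by (simp only: det')
  show ?case
  proof (intro exI[of _ b'] conjI allI ballI impI)
    show "b' i \<in> \<Lambda>" for i using b(1) uT by (auto simp: b'_def T_def)
    show "b' i = axis i 1" if "i \<notin> insert k S" for i using that b(2) by (auto simp: b'_def)
    show "b' i $ j = 0" if "i \<in> insert k S" "j \<notin> insert k S" for i j
      using that bS uT by (auto simp: b'_def T_def)
    show "0 < det (\<chi> i. b' i)" using det' h pos by simp
    show "\<exists>c. w = (\<Sum>i\<in>insert k S. of_int (c i) *\<^sub>R b' i)"
      if "w \<in> \<Lambda>" "\<forall>j. j \<notin> insert k S \<longrightarrow> w $ j = 0" for w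
      using that span' by (simp add: T_def)
  qed (rule count')
qed

text \<open>
  The index of the integer lattice is in fact the reciprocal of the determinant; the inequality is the
  half that bounds the number of cosets.
\<close>
lemma
  fixes \<Lambda> :: "(real ^ 'n::finite) set"
  assumes L: "euclidean_lattice \<Lambda>" and Z: "integer_lattice \<subseteq> \<Lambda>"
  shows lattice_det_pos: "lattice_det \<Lambda> > 0"
    and index_times_det_le_1: "real (card (unit_cell_points \<Lambda>)) * lattice_det \<Lambda> \<le> 1"
proof -
  obtain b :: "'n \<Rightarrow> real ^ 'n" where b: "\<And>i. b i \<in> \<Lambda>" and pos: "0 < det (\<chi> i. b i)"
    and span: "\<And>w. w \<in> \<Lambda> \<Longrightarrow> \<exists>c. w = (\<Sum>i\<in>UNIV. of_int (c i) *\<^sub>R b i)"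
    and count: "real (card (unit_cell_points \<Lambda>)) * det (\<chi> i. b i) \<le> 1"
    using exists_triangular_lattice_basis[OF L Z, of UNIV] by auto
  have "\<Lambda> \<subseteq> {\<Sum>i\<in>UNIV. of_int (c i) *\<^sub>R b i | c :: 'n \<Rightarrow> int. True}" using span by blast
  moreover have "{\<Sum>i\<in>UNIV. of_int (c i) *\<^sub>R b i | c :: 'n \<Rightarrow> int. True} \<subseteq> \<Lambda>"
    using euclidean_lattice_int_combination[OF L, of UNIV b] b by auto
  ultimately have "lattice_basis b \<Lambda>"
    unfolding lattice_basis_def using det_nonzero_imp_independent_rows[of b] pos
    by (simp add: subset_antisym)
  then have "lattice_det \<Lambda> = det (\<chi> i. b i)"
    using pos by (simp add: lattice_det_eq gram_det_eq_square)
  then show "lattice_det \<Lambda> > 0" "real (card (unit_cell_points \<Lambda>)) * lattice_det \<Lambda> \<le> 1"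
    using pos count by simp_all
qed

section \<open>Comparison of the theta series\<close>

theorem theorem6p1:
  fixes \<Lambda> :: "(real ^ 'n) set" and v :: "real ^ 'n" and \<tau> :: real
  assumes "euclidean_lattice \<Lambda>"
    and "integer_lattice \<subseteq> \<Lambda>"
    and "0 < \<tau>" and "\<tau> \<le> 1"
  shows "41 * exp (- (pi\<^sup>2 / \<tau>)) * (infdist v \<Lambda>)\<^sup>2
           \<ge> ln (integer_theta TYPE('n) \<tau> / lattice_theta \<Lambda> \<tau> v) \<and>
         ln (integer_theta TYPE('n) \<tau> / lattice_theta \<Lambda> \<tau> v)
           \<ge> 13 * exp (- (pi\<^sup>2 / \<tau>)) * (infdist v \<Lambda>)\<^sup>2 + ln (lattice_det \<Lambda>)"
proof -
  note L = assms(1) and Z = assms(2) and \<tau> = assms(3,4)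
  let ?R = "unit_cell_points \<Lambda>" and ?Z = "integer_lattice :: (real ^ 'n) set"
  let ?N = "real (card ?R)" and ?\<theta> = "lattice_theta \<Lambda> \<tau> v" and ?\<Theta> = "integer_theta TYPE('n) \<tau>"
  define q where "q = exp (- (pi\<^sup>2 / \<tau>))"
  define \<delta> where "\<delta> = infdist v \<Lambda>"
  have q: "0 < q" by (simp add: q_def)
  have \<Theta>: "0 < ?\<Theta>" by (rule integer_theta_pos[OF \<tau>(1)])
  have \<delta>: "0 \<le> \<delta>" by (simp add: \<delta>_def infdist_nonneg)
  have "(\<lambda>u. exp (- \<tau> * (norm (u - v))\<^sup>2)) summable_on (\<Union>c\<in>?R. (+) c ` ?Z)"
    using cosets_disjoint[OF L Z]
    by (intro summable_on_finite_union_disjoint finite_unit_cell_points[OF L] summable_on_coset \<tau>) auto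
  then have summable: "(\<lambda>u. exp (- \<tau> * (norm (u - v))\<^sup>2)) summable_on \<Lambda>"
    by (simp flip: lattice_eq_Union_cosets[OF L Z])
  have "?\<theta> = (\<Sum>\<^sub>\<infinity>u\<in>(\<Union>c\<in>?R. (+) c ` ?Z). exp (- \<tau> * (norm (u - v))\<^sup>2))"
    unfolding lattice_theta_def by (simp flip: lattice_eq_Union_cosets[OF L Z])
  also have "\<dots> = (\<Sum>c\<in>?R. lattice_theta ((+) c ` ?Z) \<tau> v)"
    unfolding lattice_theta_def using cosets_disjoint[OF L Z]
    by (intro sum_infsum[symmetric] finite_unit_cell_points[OF L] summable_on_coset \<tau>) auto
  also have "\<dots> = (\<Sum>c\<in>?R. lattice_theta ?Z \<tau> (v - c))"
    by (simp only: lattice_theta_coset[OF \<tau>(1)])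
  finally have \<theta>_sum: "?\<theta> = (\<Sum>c\<in>?R. lattice_theta ?Z \<tau> (v - c))" .
  obtain u where u: "u \<in> \<Lambda>" "\<delta> = norm (u - v)"
    unfolding \<delta>_def using euclidean_lattice_infdist_attained[OF L] by metis
  obtain z where z: "norm (v - u - z) \<le> norm (v - u)"
    "?\<Theta> * exp (- (41 * q) * (norm (v - u - z))\<^sup>2) \<le> lattice_theta ?Z \<tau> (v - u)"
    using integer_lattice_theta_bounds[OF \<tau>, of "v - u"] unfolding q_def by metis
  \<comment> \<open>The single coset through the lattice point nearest to \<open>v\<close> already gives enough mass.\<close>
  have lower: "?\<Theta> * exp (- (41 * q * \<delta>\<^sup>2)) \<le> ?\<theta>"
  proof -
    have "q * (norm (v - u - z))\<^sup>2 \<le> q * \<delta>\<^sup>2"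
      using z(1) q unfolding u(2) by (intro mult_left_mono power_mono) (auto simp: norm_minus_commute)
    then have "?\<Theta> * exp (- (41 * q * \<delta>\<^sup>2)) \<le> ?\<Theta> * exp (- (41 * q) * (norm (v - u - z))\<^sup>2)"
      using \<Theta> by simp
    also note z(2)
    also have "lattice_theta ?Z \<tau> (v - u) = lattice_theta ((+) u ` ?Z) \<tau> v"
      by (rule lattice_theta_coset[OF \<tau>(1), symmetric])
    also have "\<dots> \<le> ?\<theta>"
      unfolding lattice_theta_def using Z u(1) euclidean_lattice_add[OF L]
      by (intro infsum_mono2 summable summable_on_coset \<tau>) auto
    finally show ?thesis .
  qed
  then have \<theta>: "0 < ?\<theta>" using \<Theta> by (metis exp_gt_zero less_le_trans mult_pos_pos)
  \<comment> \<open>No point of any coset is nearer to \<open>v\<close> than \<open>\<delta>\<close>.\<close>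
  have coset: "lattice_theta ?Z \<tau> (v - c) \<le> ?\<Theta> * exp (- (13 * q * \<delta>\<^sup>2))" if c: "c \<in> ?R" for c
  proof -
    obtain z where z: "z \<in> ?Z"
      "lattice_theta ?Z \<tau> (v - c) \<le> ?\<Theta> * exp (- (13 * q) * (norm (v - c - z))\<^sup>2)"
      using integer_lattice_theta_bounds[OF \<tau>, of "v - c"] unfolding q_def by metis
    have "c + z \<in> \<Lambda>" using c z(1) Z euclidean_lattice_add[OF L] by (auto simp: unit_cell_points_def)
    then have "\<delta> \<le> norm (v - c - z)"
      using infdist_le[of "c + z" \<Lambda> v] by (simp add: \<delta>_def dist_norm algebra_simps)
    then have "q * \<delta>\<^sup>2 \<le> q * (norm (v - c - z))\<^sup>2"
      using \<delta> q by (intro mult_left_mono power_mono) auto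
    then have "?\<Theta> * exp (- (13 * q) * (norm (v - c - z))\<^sup>2) \<le> ?\<Theta> * exp (- (13 * q * \<delta>\<^sup>2))"
      using \<Theta> by simp
    with z(2) show ?thesis by linarith
  qed
  have upper: "?\<theta> \<le> ?N * (?\<Theta> * exp (- (13 * q * \<delta>\<^sup>2)))"
    unfolding \<theta>_sum using sum_bounded_above[of ?R, OF coset] by simp
  have d: "0 < lattice_det \<Lambda>" "?N * lattice_det \<Lambda> \<le> 1"
    by (rule lattice_det_pos[OF L Z] index_times_det_le_1[OF L Z])+
  have "lattice_det \<Lambda> * ?\<theta> \<le> lattice_det \<Lambda> * (?N * (?\<Theta> * exp (- (13 * q * \<delta>\<^sup>2))))"
    using upper d by (intro mult_left_mono) auto
  also have "\<dots> = (?N * lattice_det \<Lambda>) * (?\<Theta> * exp (- (13 * q * \<delta>\<^sup>2)))" by simp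
  also have "\<dots> \<le> 1 * (?\<Theta> * exp (- (13 * q * \<delta>\<^sup>2)))"
    using d \<Theta> by (intro mult_right_mono) auto
  finally have "ln (lattice_det \<Lambda> * ?\<theta>) \<le> ln (?\<Theta> * exp (- (13 * q * \<delta>\<^sup>2)))"
    using d \<theta> \<Theta> by (subst ln_le_cancel_iff) auto
  then have "ln (lattice_det \<Lambda>) + ln ?\<theta> \<le> ln ?\<Theta> - 13 * q * \<delta>\<^sup>2"
    using d \<theta> \<Theta> by (simp add: ln_mult)
  moreover have "ln (?\<Theta> * exp (- (41 * q * \<delta>\<^sup>2))) \<le> ln ?\<theta>"
    using lower \<theta> \<Theta> by (subst ln_le_cancel_iff) auto
  then have "ln ?\<Theta> - 41 * q * \<delta>\<^sup>2 \<le> ln ?\<theta>" using \<Theta> by (simp add: ln_mult)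
  ultimately show ?thesis
    using \<theta> \<Theta> by (simp add: ln_div flip: q_def \<delta>_def)
qed

end
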